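(* Let $\varepsilon>0$ be fixed and sufficiently small and $u_\varepsilon=\{z\in\mathbb{C}:|z|<\varepsilon\}$. The zeros of the polynomials $P_m(z)$ outside $u_\varepsilon$ approach the lemniscate $|1-z^2|=1$. More precisely, let $Z^{(m)}=\{z_k^{(m)}\in\mathbb{C}\setminus u_\varepsilon:\ z_k^{(m)}\text{ is a zero of }P_m(z)\}$. Then $$\max_{z_k^{(m)}\in Z^{(m)}}\ \min\left\{|z_k^{(m)}-z|:\ z\in\mathbb{C},\ |1-z^2|=1\right\}\longrightarrow 0\qquad\text{as } m\to\infty.$$
   Context: For an integer $m\ge 1$, $$P_m(z)=P_m^{(m+\frac12,-m-\frac12)}(z)=2^{-m}\sum_{k=0}^m\binom{2m+\frac12}{m-k}\binom{-\frac12}{k}(z-1)^k(z+1)^{m-k}$$ (generalized binomial coefficients), i.e. the Jacobi polynomial $P_m^{(\alpha,\beta)}$ of degree $m$ with non-classical parameters $\alpha=m+\frac12$, $\beta=-m-\frac12$. The disk $u_\varepsilon$ does not depend on $m$. *)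

theory Defs
  imports "HOL-Analysis.Analysis" "HOL-Computational_Algebra.Polynomial"
begin

text \<open>
  Jacobi polynomials with arbitrary complex parameters; \<open>gchoose\<close> is the generalized
  binomial coefficient, so no restriction on \<open>\<alpha>\<close> and \<open>\<beta>\<close> is needed.
\<close>

definition jacobi_poly :: "nat \<Rightarrow> complex \<Rightarrow> complex \<Rightarrow> complex poly" where
  "jacobi_poly n \<alpha> \<beta> =
     smult (1 / 2 ^ n)
       (\<Sum>k=0..n. smult (((of_nat n + \<alpha>) gchoose (n - k)) * ((of_nat n + \<beta>) gchoose k))
          ([:-1, 1:] ^ k * [:1, 1:] ^ (n - k)))"

definition P :: "nat \<Rightarrow> complex poly" where
  "P m = jacobi_poly m (of_nat m + 1/2) (- of_nat m - 1/2)"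

lemma poly_P:
  "poly (P m) z =
     1 / 2 ^ m * (\<Sum>k=0..m. ((2 * of_nat m + 1/2) gchoose (m - k)) * ((-1/2) gchoose k)
                        * (z - 1) ^ k * (z + 1) ^ (m - k))"
  by (simp add: P_def jacobi_poly_def poly_sum algebra_simps)

lemma P_nonzero: "P m \<noteq> 0"
proof -
  have half: "2 * of_nat m + 1/2 \<noteq> (of_nat i :: complex)" for i
  proof
    assume "2 * of_nat m + 1/2 = (of_nat i :: complex)"
    then have "of_nat (4 * m + 1) = (of_nat (2 * i) :: complex)"
      by (simp add: field_simps)
    then have "4 * m + 1 = 2 * i"
      unfolding of_nat_eq_iff .
    then show False by presburger
  qed
  have "poly (P m) 1 =
      1 / 2 ^ m * (\<Sum>k=0..m. if k = 0 then ((2 * of_nat m + 1/2) gchoose m) * 2 ^ m else 0)"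
    unfolding poly_P by (intro arg_cong2[where f="(*)"] sum.cong) auto
  also have "\<dots> = (2 * of_nat m + 1/2) gchoose m"
    by simp
  also have "\<dots> \<noteq> 0"
    using half by (simp add: gbinomial_prod_rev)
  finally show ?thesis by auto
qed

definition lemniscate :: "complex set" where
  "lemniscate = {z. cmod (1 - z\<^sup>2) = 1}"

text \<open>
  The lemniscate is closed and nonempty, so the infimum in \<open>infdist\<close> is a minimum.
\<close>

lemma infdist_lemniscate_min:
  "\<exists>w\<in>lemniscate. infdist z lemniscate = cmod (z - w) \<and> (\<forall>v\<in>lemniscate. cmod (z - w) \<le> cmod (z - v))"
proof -
  have "closed lemniscate"
    unfolding lemniscate_def by (intro closed_Collect_eq continuous_intros)
  moreover have "0 \<in> lemniscate"
    by (simp add: lemniscate_def)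
  ultimately obtain w where "w \<in> lemniscate" "infdist z lemniscate = dist z w"
    using infdist_attains_inf[of lemniscate z] by blast
  then show ?thesis
    by (metis dist_norm infdist_le)
qed

definition zeros_outside :: "real \<Rightarrow> nat \<Rightarrow> complex set" where
  "zeros_outside \<epsilon> m = {z. z \<notin> ball 0 \<epsilon> \<and> poly (P m) z = 0}"

text \<open>
  Finiteness makes \<open>Max\<close> over this set meaningful whenever it is nonempty. For \<open>\<epsilon> < 1\<close> and
  \<open>m \<ge> 1\<close> it is nonempty, as the mean of the zeros of \<open>P m\<close> is \<open>- 1 - 1 / (2 * m)\<close>.
\<close>

lemma finite_zeros_outside: "finite (zeros_outside \<epsilon> m)"
  by (rule finite_subset[OF _ poly_roots_finite[OF P_nonzero[of m]]])
     (auto simp: zeros_outside_def)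

end

theory Submission
  imports Defs "HOL-Complex_Analysis.Complex_Analysis" "HOL-Computational_Algebra.Fundamental_Theorem_Algebra"
begin

text \<open>
  Write \<open>y = 1 + z\<close> and \<open>s = sqrt (1 - u)\<close>. The polynomials have the generating function
  \<open>(\<Sum>m. P m z / (2 * y) ^ m * u ^ m) = 1 / s * sqrt (y / (z + s))\<close> (\<open>generating_function_P\<close>), so the
  growth of \<open>P m z\<close> is governed by the singularity in \<open>u\<close> that is closest to the origin. There are two
  candidates: \<open>u = 1\<close>, where \<open>s\<close> vanishes, and \<open>u = 1 - z\<^sup>2\<close>, where \<open>s\<close> is a square root of \<open>z\<^sup>2\<close>.
  The second one is singular on the principal branch only if this root is \<open>-z\<close>, i.e. if
  \<open>Re z < 0\<close>. The lemniscate is exactly the set where both are equally far from the origin, so a zero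
  of \<open>P m\<close>, for which the two contributions have to cancel, can only be close to it when \<open>m\<close> is large.

  Off the lemniscate one singularity dominates, and it is an inverse square root in both cases. If
  \<open>z\<close> is outside the left loop, the dominating singularity is \<open>u = 1\<close>, and the coefficients
  decay like those of \<open>1 / sqrt (1 - u)\<close> (\<open>P_nonzero_endpoint\<close>). Inside the left loop the dominating
  singularity is \<open>u = 1 - z\<^sup>2\<close>; after rescaling \<open>u = (1 - z\<^sup>2) * t\<close> the function is
  \<open>1 / sqrt (1 - t)\<close> times a function that is holomorphic beyond the unit disk (\<open>P_nonzero_saddle\<close>).

  What is needed is nonvanishing for all large \<open>m\<close> uniformly in \<open>z\<close> at distance at least \<open>\<delta>\<close> from the
  lemniscate. The criterion \<open>taylor_coeff_nonzero\<close> gives it with an explicit threshold: the operator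
  \<open>f \<mapsto> 2 * (1 - u) * f' - f\<close> annihilates \<open>1 / sqrt (1 - u)\<close>, and applying it, differentiating and applying
  it again leaves a function that is bounded on the unit disk. The bound then controls how far
  the Taylor coefficients deviate from a multiple of those of \<open>1 / sqrt (1 - u)\<close>.

  The maximum over the zeros is meaningful because for \<open>m > 0\<close> there is a zero with \<open>norm z \<ge> 1/2\<close>:
  the product of all \<open>norm (1 + z)\<close> over the zeros of \<open>P m\<close> is \<open>(1/2) ^ m\<close>
  (\<open>zeros_outside_nonempty\<close>).
\<close>

section \<open>Scaled central binomial coefficients\<close>

text \<open>
  These are the Taylor coefficients of \<open>1 / sqrt (1 - x)\<close>, the comparison function for both kinds of
  singularities.
\<close>

definition central_coeff :: "nat \<Rightarrow> real" where
  "central_coeff n = real (2 * n choose n) / 4 ^ n"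

lemma central_coeff_0 [simp]: "central_coeff 0 = 1"
  by (simp add: central_coeff_def)

lemma central_coeff_Suc:
  "central_coeff (Suc n) = central_coeff n * (2 * real n + 1) / (2 * real n + 2)"
proof -
  have 1: "real (2 * n choose n) = fact (2 * n) / (fact n * fact n)"
    by (simp add: binomial_fact)
  have 2: "real (2 * Suc n choose Suc n) = fact (2 * Suc n) / (fact (Suc n) * fact (Suc n))"
    by (subst binomial_fact) auto
  have 3: "(fact (2 * Suc n) :: real) = (2 * real n + 2) * (2 * real n + 1) * fact (2 * n)"
    by (simp add: algebra_simps)
  show ?thesis
    unfolding central_coeff_def 1 2 3
    by (simp add: divide_simps del: of_nat_Suc)
       (simp add: algebra_simps)
qed

lemma central_coeff_pos [simp]: "central_coeff n > 0"
  by (simp add: central_coeff_def)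

lemma of_real_central_coeff:
  "(of_real (central_coeff n) :: 'a::real_field) = (-1) ^ n * ((-1/2) gchoose n)"
proof (induction n)
  case (Suc n)
  let ?a = "-1/2 :: 'a"
  have "of_nat (Suc n) * (?a gchoose Suc n) = (?a - of_nat n) * (?a gchoose n)"
    using gbinomial_mult_1[of ?a n] by (simp add: algebra_simps)
  then have "?a gchoose Suc n = (?a gchoose n) * (?a - of_nat n) / of_nat (Suc n)"
    by (metis nonzero_mult_div_cancel_left of_nat_eq_0_iff nat.distinct(1) mult.commute)
  moreover have "(2 * real n + 1) / (2 * real n + 2) = - ((-1/2 - real n) / real (Suc n))"
    by (simp add: divide_simps) (simp add: algebra_simps)
  then have "(of_real ((2 * real n + 1) / (2 * real n + 2)) :: 'a) = of_real (- ((-1/2 - real n) / real (Suc n)))"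
    by (simp only:)
  then have "(of_real ((2 * real n + 1) / (2 * real n + 2)) :: 'a) = - ((?a - of_nat n) / of_nat (Suc n))"
    by simp
  moreover have "(of_real (central_coeff (Suc n)) :: 'a) =
      of_real (central_coeff n) * of_real ((2 * real n + 1) / (2 * real n + 2))"
    by (simp only: central_coeff_Suc of_real_mult[symmetric] times_divide_eq_right)
  ultimately show ?case
    using Suc.IH by simp
qed auto

lemma central_coeff_lower: "n > 0 \<Longrightarrow> 1 / (2 * sqrt (real n)) \<le> central_coeff n"
proof (induction n rule: nat_induct_non_zero)
  case 1
  show ?case by (simp add: central_coeff_Suc[of 0, simplified])
next
  case (Suc n)
  have "sqrt (real n) * sqrt (real (Suc n)) * 2 \<le> 2 * real n + 1"
  proof (rule power2_le_imp_le)
    show "(sqrt (real n) * sqrt (real (Suc n)) * 2)\<^sup>2 \<le> (2 * real n + 1)\<^sup>2"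
      by (simp add: power_mult_distrib) (simp add: power2_eq_square algebra_simps)
  qed auto
  moreover have "sqrt (real (Suc n)) * sqrt (real (Suc n)) = real n + 1"
    by simp
  ultimately have "sqrt (real n) * (2 * (real n + 1)) \<le> sqrt (real (Suc n)) * (2 * real n + 1)"
    using mult_left_mono[of "sqrt (real n) * sqrt (real (Suc n)) * 2" "2 * real n + 1" "sqrt (real (Suc n))"]
    by (simp add: mult_ac del: of_nat_Suc) (simp add: algebra_simps)
  then have "1 / (2 * sqrt (real (Suc n))) \<le> 1 / (2 * sqrt (real n)) * ((2 * real n + 1) / (2 * real n + 2))"
    using Suc.hyps by (simp add: divide_simps mult_ac) (simp add: algebra_simps)
  also have "\<dots> \<le> central_coeff n * ((2 * real n + 1) / (2 * real n + 2))"
    by (intro mult_right_mono Suc.IH) auto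
  finally show ?case by (simp add: central_coeff_Suc)
qed

lemma central_coeff_sums:
  assumes "\<bar>x\<bar> < 1"
  shows "(\<lambda>n. central_coeff n * x ^ n) sums (1 / sqrt (1 - x))"
proof -
  have "(\<lambda>n. ((-1/2) gchoose n) * (-x) ^ n) sums (1 + (-x)) powr (-1/2)"
    using assms by (intro gen_binomial_real) auto
  moreover have "(1 + (-x)) powr (-1/2) = 1 / sqrt (1 - x)"
    using assms by (simp add: powr_minus_divide powr_half_sqrt)
  moreover have "central_coeff n = (-1) ^ n * ((-1/2) gchoose n)" for n
    using of_real_central_coeff[of n, where 'a = real] by simp
  ultimately show ?thesis
    by (simp add: mult_ac power_minus[of x])
qed

section \<open>Expansion at \<open>-1\<close>\<close>

text \<open>
  Expanding \<open>z - 1 = (z + 1) - 2\<close> by the binomial theorem, the coefficient of each power of \<open>z + 1\<close> is a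
  Vandermonde convolution, in which the half-integers cancel. In this form the generating function
  becomes visible.
\<close>

lemma poly_P_shifted:
  "poly (P m) z = (\<Sum>i\<le>m. of_real (central_coeff i) * 2 ^ i * of_nat (2 * m - i choose m) * (z + 1) ^ (m - i)) / 2 ^ m"
proof -
  let ?A = "\<lambda>k. ((2 * of_nat m + 1/2) gchoose k) :: complex"
  let ?B = "\<lambda>k. ((-1/2) gchoose k) :: complex"
  have expand: "(z - 1) ^ k * (z + 1) ^ (m - k) =
      (\<Sum>i\<le>m. of_nat (k choose i) * (-2) ^ i * (z + 1) ^ (m - i))" if "k \<le> m" for k
  proof -
    have "(z - 1) ^ k = (-2 + (z + 1)) ^ k" by simp
    also have "\<dots> = (\<Sum>i\<le>k. of_nat (k choose i) * (-2) ^ i * (z + 1) ^ (k - i))"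
      by (rule binomial_ring)
    finally have "(z - 1) ^ k * (z + 1) ^ (m - k) =
        (\<Sum>i\<le>k. of_nat (k choose i) * (-2) ^ i * ((z + 1) ^ (k - i) * (z + 1) ^ (m - k)))"
      by (simp add: sum_distrib_right mult.assoc)
    also have "\<dots> = (\<Sum>i\<le>k. of_nat (k choose i) * (-2) ^ i * (z + 1) ^ (m - i))"
      using that by (intro sum.cong) (auto simp flip: power_add)
    also have "\<dots> = (\<Sum>i\<le>m. of_nat (k choose i) * (-2) ^ i * (z + 1) ^ (m - i))"
      using that by (intro sum.mono_neutral_left) auto
    finally show ?thesis .
  qed
  have inner: "(\<Sum>k\<le>m. ?A (m - k) * ?B k * of_nat (k choose i)) = ?B i * of_nat (2 * m - i choose m)"
    if "i \<le> m" for i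
  proof -
    have "(\<Sum>k\<le>m. ?A (m - k) * ?B k * of_nat (k choose i)) =
        (\<Sum>k\<in>{i..m}. ?A (m - k) * ?B k * of_nat (k choose i))"
      by (intro sum.mono_neutral_right) auto
    also have "\<dots> = (\<Sum>j\<in>{0..m-i}. ?A (m - i - j) * ?B (i + j) * of_nat (i + j choose i))"
      using that by (intro sum.reindex_bij_witness[of _ "\<lambda>j. i + j" "\<lambda>k. k - i"]) auto
    also have "\<dots> = (\<Sum>j\<in>{0..m-i}. ?B i * (((-1/2 - of_nat i) gchoose j) * ?A (m - i - j)))"
    proof (intro sum.cong refl)
      fix j
      have "?B (i + j) * of_nat (i + j choose i) = ?B i * ((-1/2 - of_nat i) gchoose j)"
        using gbinomial_trinomial_revision[of i "i + j" "-1/2 :: complex"]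
        unfolding binomial_gbinomial by simp
      then show "?A (m - i - j) * ?B (i + j) * of_nat (i + j choose i) =
          ?B i * (((-1/2 - of_nat i) gchoose j) * ?A (m - i - j))"
        by (simp only: mult.assoc) (simp only: mult_ac)
    qed
    also have "\<dots> = ?B i * ((-1/2 - of_nat i + (2 * of_nat m + 1/2)) gchoose (m - i))"
      by (simp only: sum_distrib_left[symmetric] gbinomial_Vandermonde)
    also have "-1/2 - of_nat i + (2 * of_nat m + 1/2) = (of_nat (2 * m - i) :: complex)"
      using that by (simp add: of_nat_diff)
    also have "of_nat (2 * m - i) gchoose (m - i) = (of_nat (2 * m - i choose (m - i)) :: complex)"
      by (simp add: binomial_gbinomial)
    also have "2 * m - i choose (m - i) = 2 * m - i choose m"
      using that by (subst binomial_symmetric) auto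
    finally show ?thesis .
  qed
  have "2 ^ m * poly (P m) z =
      (\<Sum>k\<le>m. ?A (m - k) * ?B k * ((z - 1) ^ k * (z + 1) ^ (m - k)))"
    by (simp add: poly_P atLeast0AtMost mult.assoc)
  also have "\<dots> = (\<Sum>k\<le>m. \<Sum>i\<le>m. ?A (m - k) * ?B k * of_nat (k choose i) * ((-2) ^ i * (z + 1) ^ (m - i)))"
    by (intro sum.cong refl) (simp add: expand sum_distrib_left mult.assoc)
  also have "\<dots> = (\<Sum>i\<le>m. (\<Sum>k\<le>m. ?A (m - k) * ?B k * of_nat (k choose i)) * ((-2) ^ i * (z + 1) ^ (m - i)))"
    by (subst sum.swap) (simp add: sum_distrib_right)
  also have "\<dots> = (\<Sum>i\<le>m. of_real (central_coeff i) * 2 ^ i * of_nat (2 * m - i choose m) * (z + 1) ^ (m - i))"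
  proof (intro sum.cong refl)
    fix i assume "i \<in> {..m}"
    then have "(\<Sum>k\<le>m. ?A (m - k) * ?B k * of_nat (k choose i)) = ?B i * of_nat (2 * m - i choose m)"
      by (intro inner) simp
    moreover have "(-2::complex) ^ i = (-1) ^ i * 2 ^ i"
      by (simp flip: power_mult_distrib)
    ultimately show "(\<Sum>k\<le>m. ?A (m - k) * ?B k * of_nat (k choose i)) * ((-2) ^ i * (z + 1) ^ (m - i)) =
        of_real (central_coeff i) * 2 ^ i * of_nat (2 * m - i choose m) * (z + 1) ^ (m - i)"
      by (simp only: of_real_central_coeff) (simp only: mult_ac)
  qed
  finally show ?thesis
    by (simp add: field_simps)
qed

lemma coeff_linear_power_prod:
  fixes a b :: "'a::idom"
  shows "coeff ([:a, 1:] ^ k * [:b, 1:] ^ l) (k + l) = 1"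
    and "degree ([:a, 1:] ^ k * [:b, 1:] ^ l) = k + l"
proof -
  show "degree ([:a, 1:] ^ k * [:b, 1:] ^ l) = k + l"
    by (subst degree_mult_eq) (auto simp: degree_linear_power)
  moreover have "lead_coeff ([:a, 1:] ^ k * [:b, 1:] ^ l) = 1"
    by (simp add: lead_coeff_mult lead_coeff_power)
  ultimately show "coeff ([:a, 1:] ^ k * [:b, 1:] ^ l) (k + l) = 1"
    by simp
qed

lemma coeff_P: "coeff (P m) m = 2 ^ m * of_real (central_coeff m)"
proof -
  have "coeff ([:-1, 1:] ^ k * [:1, 1:] ^ (m - k)) m = (1::complex)" if "k \<le> m" for k
    using coeff_linear_power_prod(1)[of "-1::complex" k 1 "m - k"] that by simp
  then have "coeff (P m) m = (\<Sum>k=0..m. ((-1/2) gchoose k) * ((2 * of_nat m + 1/2) gchoose (m - k))) / 2 ^ m"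
    by (simp add: P_def jacobi_poly_def coeff_sum mult_ac)
  also have "\<dots> = of_nat (2 * m choose m) / 2 ^ m"
    unfolding gbinomial_Vandermonde by (simp add: binomial_gbinomial)
  also have "\<dots> = 2 ^ m * of_real (central_coeff m)"
    by (simp add: central_coeff_def field_simps flip: power_mult_distrib)
  finally show ?thesis .
qed

lemma degree_P: "degree (P m) = m"
proof (rule antisym)
  show "degree (P m) \<le> m"
    unfolding P_def jacobi_poly_def
    by (intro order.trans[OF degree_smult_le] degree_sum_le)
       (auto intro!: order.trans[OF degree_smult_le] simp: coeff_linear_power_prod(2))
  have "coeff (P m) m \<noteq> 0"
    using less_imp_neq[OF central_coeff_pos[of m]] by (simp add: coeff_P)
  then show "m \<le> degree (P m)" by (rule le_degree)
qed

lemma poly_P_minus_1: "poly (P m) (-1) = of_real (central_coeff m)"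
proof -
  have "(\<Sum>i\<le>m. of_real (central_coeff i) * 2 ^ i * of_nat (2 * m - i choose m) * (-1 + 1) ^ (m - i)) =
     (\<Sum>i\<le>m. if i = m then of_real (central_coeff m) * 2 ^ m else (0::complex))"
    by (intro sum.cong) auto
  then show ?thesis by (simp add: poly_P_shifted)
qed

text \<open>
  The product of \<open>norm (1 + z)\<close> over the zeros is the modulus of \<open>P m\<close> at \<open>-1\<close> divided by that of the
  leading coefficient; this quotient is \<open>(1/2) ^ m\<close>. If all zeros had modulus less than \<open>1/2\<close>, each factor
  would exceed \<open>1/2\<close>.
\<close>

lemma zeros_outside_nonempty:
  assumes "\<epsilon> \<le> 1/2" "m > 0"
  shows "zeros_outside \<epsilon> m \<noteq> {}"
proof
  assume empty: "zeros_outside \<epsilon> m = {}"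
  obtain A where A: "size A = m" "P m = smult (coeff (P m) m) (\<Prod>x\<in>#A. [:-x, 1:])"
    using alg_closed_imp_factorization[OF P_nonzero[of m]] by (auto simp: degree_P)
  have root: "norm (1 + x) > 1/2" if "x \<in># A" for x
  proof -
    have "poly (\<Prod>x\<in>#A. [:-x, 1:]) x = 0"
      using that by (auto simp: poly_prod_mset prod_mset_zero_iff)
    then have "poly (P m) x = 0" by (subst A(2)) simp
    then have "norm x < 1/2"
      using empty assms by (force simp: zeros_outside_def)
    then show ?thesis
      using norm_triangle_ineq2[of 1 "-x"] by simp
  qed
  have prod_gt: "norm (\<Prod>x\<in>#B. 1 + x) > (1/2) ^ size B"
    if "\<And>x. x \<in># B \<Longrightarrow> norm (1 + x) > 1/2" "B \<noteq> {#}" for B :: "complex multiset"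
    using that
  proof (induction B)
    case (add x B)
    show ?case
    proof (cases "B = {#}")
      case False
      then have "(1/2) ^ size B < norm (\<Prod>x\<in>#B. 1 + x)" "1/2 < norm (1 + x)"
        using add by auto
      then have "1/2 * (1/2) ^ size B < norm (1 + x) * norm (\<Prod>x\<in>#B. 1 + x)"
        by (intro mult_strict_mono') auto
      then show ?thesis
        by (simp add: norm_mult)
    qed (use add.prems in auto)
  qed auto
  have "norm (poly (\<Prod>x\<in>#B. [:-x, 1:]) (-1)) = norm (\<Prod>x\<in>#B. 1 + x)" for B :: "complex multiset"
  proof (induction B)
    case (add x B)
    have "poly [:-x, 1:] (-1) = - (1 + x)" by simp
    then have "norm (poly [:-x, 1:] (-1)) = norm (1 + x)"
      by (simp only: norm_minus_cancel)
    then show ?case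
      by (simp only: image_mset_add_mset prod_mset.add_mset poly_mult norm_mult add.IH)
  qed simp
  moreover have "poly (P m) (-1) = coeff (P m) m * poly (\<Prod>x\<in>#A. [:-x, 1:]) (-1)"
    by (subst A(2)) simp
  ultimately have "norm (poly (P m) (-1)) = norm (coeff (P m) m) * norm (\<Prod>x\<in>#A. 1 + x)"
    by (simp only: norm_mult)
  then have "central_coeff m = 2 ^ m * central_coeff m * norm (\<Prod>x\<in>#A. 1 + x)"
    using less_imp_le[OF central_coeff_pos[of m]]
    by (simp add: poly_P_minus_1 coeff_P norm_mult norm_power)
  then have "(1/2) ^ m = norm (\<Prod>x\<in>#A. 1 + x)"
    using central_coeff_pos[of m] by (simp add: field_simps)
  moreover have "A \<noteq> {#}" using A(1) assms(2) by auto
  ultimately show False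
    using prod_gt[OF root, of A] A(1) by simp
qed

section \<open>The generating function\<close>

definition invsqrt_fps :: "complex fps" where
  "invsqrt_fps = Abs_fps (\<lambda>n. of_real (central_coeff n))"

lemma invsqrt_fps_nth [simp]: "invsqrt_fps $ n = of_real (central_coeff n)"
  by (simp add: invsqrt_fps_def)

lemma invsqrt_fps_square: "invsqrt_fps * invsqrt_fps * (1 - fps_X) = 1"
proof -
  have "invsqrt_fps * invsqrt_fps = Abs_fps (\<lambda>_. 1)"
  proof (rule fps_ext)
    fix n
    have "(invsqrt_fps * invsqrt_fps) $ n =
        (\<Sum>i=0..n. (-1) ^ n * (((-1/2) gchoose i) * ((-1/2) gchoose (n - i))))"
      unfolding fps_mult_nth
    proof (intro sum.cong refl)
      fix i assume "i \<in> {0..n}"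
      then have "(-1::complex) ^ n = (-1) ^ i * (-1) ^ (n - i)"
        by (simp flip: power_add)
      then show "invsqrt_fps $ i * invsqrt_fps $ (n - i) =
          (-1) ^ n * (((-1/2) gchoose i) * ((-1/2) gchoose (n - i)))"
        by (simp add: of_real_central_coeff)
    qed
    also have "\<dots> = (-1) ^ n * ((-1) gchoose n)"
      by (simp add: gbinomial_Vandermonde flip: sum_distrib_left)
    also have "((-1) gchoose n) = (-1::complex) ^ n"
      using gbinomial_minus[of "1::complex" n] binomial_gbinomial[of n n, where 'a = complex]
      by simp
    finally show "(invsqrt_fps * invsqrt_fps) $ n = Abs_fps (\<lambda>_. 1) $ n"
      by (simp flip: power_mult_distrib)
  qed
  then show ?thesis
    by (intro fps_ext) (auto simp: right_diff_distrib)
qed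

text \<open>
  The square root of \<open>1 - X\<close> is \<open>(1 - X) / sqrt (1 - X)\<close>; its complement to 1 has no constant term
  and can be substituted into power series.
\<close>

definition one_minus_sqrt_fps :: "complex fps" where
  "one_minus_sqrt_fps = 1 - (1 - fps_X) * invsqrt_fps"

lemma one_minus_sqrt_fps_0 [simp]: "one_minus_sqrt_fps $ 0 = 0"
  by (simp add: one_minus_sqrt_fps_def)

lemma sqrt_fps_square: "(1 - one_minus_sqrt_fps)\<^sup>2 = 1 - fps_X"
proof -
  have "(1 - one_minus_sqrt_fps)\<^sup>2 = (1 - fps_X) * (invsqrt_fps * invsqrt_fps * (1 - fps_X))"
    by (simp add: one_minus_sqrt_fps_def power2_eq_square mult_ac)
  then show ?thesis by (simp add: invsqrt_fps_square)
qed

text \<open>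
  With \<open>T = 1 - sqrt (1 - X)\<close>, the relation \<open>T\<^sup>2 = 2 * T - X\<close> turns into Pascal's rule for the
  coefficients of \<open>T ^ i / sqrt (1 - X)\<close>.
\<close>

lemma one_minus_sqrt_fps_power_nth:
  "(one_minus_sqrt_fps ^ i * invsqrt_fps) $ n =
     (if i \<le> n then of_nat (2 * n - i choose n) * 2 ^ i / 4 ^ n else 0)"
proof -
  define B where "B i = Abs_fps (\<lambda>n. if i \<le> n then of_nat (2 * n - i choose n) * 2 ^ i / 4 ^ n else (0::complex))"
    for i
  have rec: "B (Suc (Suc i)) = 2 * B (Suc i) - fps_X * B i" for i
  proof (rule fps_ext)
    fix n
    show "B (Suc (Suc i)) $ n = (2 * B (Suc i) - fps_X * B i) $ n"
    proof (cases n)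
      case 0
      then show ?thesis by (simp add: B_def numeral_fps_const)
    next
      case (Suc k)
      consider "i < k" | "i = k" | "k < i" by linarith
      then show ?thesis
      proof cases
        case 1
        then obtain d where k: "k = i + Suc d"
          using less_iff_Suc_add by auto
        have "2 * k - i = i + 2 * d + 2" "2 * n - Suc i = i + 2 * d + 3" "2 * n - Suc (Suc i) = i + 2 * d + 2"
          using Suc k by auto
        moreover have "i + 2 * d + 3 choose Suc k = (i + 2 * d + 2 choose k) + (i + 2 * d + 2 choose Suc k)"
          using binomial_Suc_Suc[of "i + 2 * d + 2" k] by (simp only: eval_nat_numeral add_Suc_right)
        ultimately show ?thesis
          using 1 Suc by (simp add: B_def numeral_fps_const field_simps)
      next
        case 2
        then show ?thesis using Suc by (simp add: B_def numeral_fps_const)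
      qed (use Suc in \<open>simp add: B_def numeral_fps_const\<close>)
    qed
  qed
  have square: "one_minus_sqrt_fps * one_minus_sqrt_fps = 2 * one_minus_sqrt_fps - fps_X"
    using sqrt_fps_square by (simp add: power2_eq_square algebra_simps)
  have "one_minus_sqrt_fps ^ i * invsqrt_fps = B i"
  proof (induction i rule: induct_nat_012)
    case 0
    show ?case
      by (intro fps_ext) (simp add: B_def central_coeff_def)
  next
    case 1
    have "one_minus_sqrt_fps * invsqrt_fps = invsqrt_fps - invsqrt_fps * invsqrt_fps * (1 - fps_X)"
      by (simp add: one_minus_sqrt_fps_def algebra_simps)
    also have "\<dots> = invsqrt_fps - 1"
      by (simp only: invsqrt_fps_square)
    also have "\<dots> = B 1"
    proof (rule fps_ext)
      fix n
      show "(invsqrt_fps - 1) $ n = B 1 $ n"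
      proof (cases n)
        case (Suc k)
        have "2 * n choose n = (2 * k + 1 choose k) + (2 * k + 1 choose n)"
          using Suc binomial_Suc_Suc[of "2 * k + 1" k] by simp
        also have "2 * k + 1 choose k = 2 * n - 1 choose n"
          using Suc by (subst binomial_symmetric) auto
        also have "2 * k + 1 = 2 * n - 1" using Suc by simp
        finally have "(of_nat (2 * n choose n) :: complex) = of_nat ((2 * n - 1 choose n) + (2 * n - 1 choose n))"
          by (rule arg_cong)
        then show ?thesis
          using Suc by (simp add: B_def central_coeff_def)
      qed (simp add: B_def)
    qed
    finally show ?case by simp
  next
    case (ge2 i)
    have "one_minus_sqrt_fps ^ Suc (Suc i) * invsqrt_fps =
        2 * (one_minus_sqrt_fps ^ Suc i * invsqrt_fps) - fps_X * (one_minus_sqrt_fps ^ i * invsqrt_fps)"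
      using arg_cong[OF square, of "\<lambda>F. F * (one_minus_sqrt_fps ^ i * invsqrt_fps)"]
      by (simp only: power_Suc left_diff_distrib mult.assoc)
    then show ?case by (simp only: rec ge2)
  qed
  then show ?thesis by (simp add: B_def)
qed

text \<open>
  With \<open>s = sqrt (1 - X)\<close> and \<open>y = 1 + z\<close> this is \<open>1 / (s * sqrt (1 - (1 - s) / y))\<close>, where
  \<open>1 - (1 - s) / y = (z + s) / y\<close>.
\<close>

definition P_fps :: "complex \<Rightarrow> complex fps" where
  "P_fps y = invsqrt_fps * (invsqrt_fps oo (fps_const (1 / y) * one_minus_sqrt_fps))"

lemma P_fps_nth:
  assumes "z \<noteq> -1"
  shows "P_fps (1 + z) $ m = poly (P m) z / (2 * (1 + z)) ^ m"
proof -
  define y where "y = 1 + z"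
  have y: "y \<noteq> 0" using assms by (auto simp: y_def add_eq_0_iff)
  let ?T = "fps_const (1 / y) * one_minus_sqrt_fps"
  have T0: "(?T ^ i) $ n = 0" if "n < i" for i n
    using startsby_zero_power_prefix[of ?T i] that by simp
  have "P_fps y $ m = (\<Sum>k=0..m. invsqrt_fps $ k * (\<Sum>i=0..m-k. invsqrt_fps $ i * (?T ^ i) $ (m - k)))"
    by (simp add: P_fps_def fps_mult_nth fps_compose_nth)
  also have "\<dots> = (\<Sum>k=0..m. invsqrt_fps $ k * (\<Sum>i\<le>m. invsqrt_fps $ i * (?T ^ i) $ (m - k)))"
  proof -
    have "(\<Sum>i=0..m-k. invsqrt_fps $ i * (?T ^ i) $ (m - k)) = (\<Sum>i\<le>m. invsqrt_fps $ i * (?T ^ i) $ (m - k))" for k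
      by (intro sum.mono_neutral_left ballI) (auto simp: T0)
    then show ?thesis by (simp only:)
  qed
  also have "\<dots> = (\<Sum>i\<le>m. invsqrt_fps $ i * (?T ^ i * invsqrt_fps) $ m)"
    unfolding sum_distrib_left
    by (subst sum.swap) (simp add: mult.commute[of "?T ^ _" invsqrt_fps] fps_mult_nth sum_distrib_left mult_ac)
  also have "\<dots> = (\<Sum>i\<le>m. of_real (central_coeff i) * ((1 / y) ^ i * (of_nat (2 * m - i choose m) * 2 ^ i / 4 ^ m)))"
  proof (intro sum.cong refl)
    fix i assume "i \<in> {..m}"
    moreover have "?T ^ i * invsqrt_fps = fps_const ((1 / y) ^ i) * (one_minus_sqrt_fps ^ i * invsqrt_fps)"
      by (simp add: power_mult_distrib fps_const_power mult.assoc)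
    ultimately show "invsqrt_fps $ i * (?T ^ i * invsqrt_fps) $ m =
        of_real (central_coeff i) * ((1 / y) ^ i * (of_nat (2 * m - i choose m) * 2 ^ i / 4 ^ m))"
      by (simp only: fps_mult_left_const_nth one_minus_sqrt_fps_power_nth invsqrt_fps_nth atMost_iff if_True)
  qed
  also have "\<dots> = (\<Sum>i\<le>m. of_real (central_coeff i) * 2 ^ i * of_nat (2 * m - i choose m) * y ^ (m - i) / (4 ^ m * y ^ m))"
    using y by (intro sum.cong refl) (simp add: power_diff field_simps)
  also have "\<dots> = poly (P m) z / (2 * y) ^ m"
  proof -
    have "(4::complex) ^ m = 2 ^ m * 2 ^ m" by (simp flip: power_mult_distrib)
    then show ?thesis
      by (simp only: poly_P_shifted y_def add.commute[of z] power_mult_distrib sum_divide_distrib[symmetric]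
            divide_divide_eq_left mult.assoc)
  qed
  finally show ?thesis by (simp add: y_def)
qed

lemma P_fps_square:
  assumes "z \<noteq> -1"
  shows "(P_fps (1 + z))\<^sup>2 * ((1 - fps_X) * (fps_const z + (1 - one_minus_sqrt_fps))) = fps_const (1 + z)"
proof -
  define y where "y = 1 + z"
  have y: "y \<noteq> 0" using assms by (auto simp: y_def add_eq_0_iff)
  let ?T = "fps_const (1 / y) * one_minus_sqrt_fps"
  let ?C = "invsqrt_fps oo ?T"
  have "(invsqrt_fps * invsqrt_fps * (1 - fps_X)) oo ?T = 1"
    by (simp add: invsqrt_fps_square)
  then have C: "?C * ?C * (1 - ?T) = 1"
    by (simp add: fps_compose_mult_distrib fps_compose_sub_distrib)
  have "fps_const z + (1 - one_minus_sqrt_fps) = fps_const y - one_minus_sqrt_fps"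
    by (simp add: y_def flip: fps_const_add)
  also have "\<dots> = fps_const y * (1 - ?T)"
    using y by (simp add: right_diff_distrib flip: mult.assoc)
  finally have "(P_fps y)\<^sup>2 * ((1 - fps_X) * (fps_const z + (1 - one_minus_sqrt_fps))) =
      fps_const y * (invsqrt_fps * invsqrt_fps * (1 - fps_X)) * (?C * ?C * (1 - ?T))"
    by (simp add: P_fps_def power2_eq_square mult_ac)
  also have "\<dots> = fps_const y"
    by (simp only: C invsqrt_fps_square mult_1_right)
  finally show ?thesis by (simp only: y_def)
qed

lemma fps_eq_if_square_eq:
  fixes F G :: "'a::{idom,ring_char_0} fps"
  assumes "F\<^sup>2 = G\<^sup>2" "F $ 0 = 1" "G $ 0 = 1"
  shows "F = G"
proof -
  have "F \<noteq> - G"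
  proof
    assume "F = - G"
    then have "F $ 0 = - (G $ 0)" by simp
    then show False using assms by simp
  qed
  then show ?thesis using assms(1) by (simp add: power2_eq_iff)
qed

lemma has_fps_expansion_csqrt_1_minus:
  "(\<lambda>u. csqrt (1 - u)) has_fps_expansion (1 - one_minus_sqrt_fps)"
proof -
  have hol: "(\<lambda>u. csqrt (1 - u)) holomorphic_on ball 0 1"
  proof (intro holomorphic_intros)
    fix u :: complex assume "u \<in> ball 0 1"
    then have "Re u < 1" using abs_Re_le_cmod[of u] by simp
    then show "1 - u \<notin> \<real>\<^sub>\<le>\<^sub>0" by (auto simp: complex_nonpos_Reals_iff)
  qed
  define S where "S = fps_expansion (\<lambda>u. csqrt (1 - u)) 0"
  have S: "(\<lambda>u. csqrt (1 - u)) has_fps_expansion S"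
    unfolding S_def by (rule has_fps_expansion_fps_expansion[OF _ _ hol]) auto
  then have "(\<lambda>u. csqrt (1 - u) ^ 2) has_fps_expansion S\<^sup>2"
    by (intro fps_expansion_intros)
  moreover have "(\<lambda>u::complex. 1 - u) has_fps_expansion 1 - fps_X"
    by (intro fps_expansion_intros)
  ultimately have "S\<^sup>2 = (1 - one_minus_sqrt_fps)\<^sup>2"
    unfolding sqrt_fps_square power2_csqrt by (rule fps_expansion_unique_complex)
  moreover have "S $ 0 = 1"
    using has_fps_expansion_imp_0_eq_fps_nth_0[OF S] by simp
  moreover have "(1 - one_minus_sqrt_fps) $ 0 = 1"
    by simp
  ultimately have "S = 1 - one_minus_sqrt_fps"
    by (rule fps_eq_if_square_eq)
  with S show ?thesis by simp
qed

text \<open>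
  The generating function is a square root of \<open>(1 + z) / ((1 - u) * (z + sqrt (1 - u)))\<close>. Stating the
  result for any holomorphic square root \<open>f\<close> of this function, normalised by \<open>f 0 = 1\<close>, leaves the choice
  of the branch to the applications; the formal power series is determined by its square and
  its constant term.
\<close>

lemma generating_function_P:
  assumes z: "z \<noteq> -1" and A: "open A" "0 \<in> A" and hol: "f holomorphic_on A" and f0: "f 0 = 1"
    and f: "\<And>u. u \<in> A \<Longrightarrow> (f u)\<^sup>2 * ((1 - u) * (z + csqrt (1 - u))) = 1 + z"
  shows "(deriv ^^ m) f 0 / fact m = poly (P m) z / (2 * (1 + z)) ^ m"
proof -
  define F where "F = fps_expansion f 0"
  have F: "f has_fps_expansion F"
    unfolding F_def by (rule has_fps_expansion_fps_expansion[OF A hol])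
  let ?R = "(1 - fps_X) * (fps_const z + (1 - one_minus_sqrt_fps))"
  have "(\<lambda>u. (f u)\<^sup>2 * ((1 - u) * (z + csqrt (1 - u)))) has_fps_expansion F\<^sup>2 * ?R"
    by (intro fps_expansion_intros F has_fps_expansion_csqrt_1_minus)
  moreover have "eventually (\<lambda>u. (f u)\<^sup>2 * ((1 - u) * (z + csqrt (1 - u))) = 1 + z) (nhds 0)"
    using eventually_nhds_in_open[OF A] by eventually_elim (rule f)
  note has_fps_expansion_cong[OF this refl]
  ultimately have "(\<lambda>_. 1 + z) has_fps_expansion F\<^sup>2 * ?R"
    by (rule iffD1[rotated])
  then have "F\<^sup>2 * ?R = fps_const (1 + z)"
    by (rule fps_expansion_unique_complex) (rule has_fps_expansion_const)
  then have eq: "F\<^sup>2 * ?R = (P_fps (1 + z))\<^sup>2 * ?R"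
    using P_fps_square[OF z] by simp
  have "?R $ 0 = 1 + z" by simp
  then have "?R \<noteq> 0"
    using z by (auto simp: add_eq_0_iff simp del: fps_mult_nth_0)
  with eq have "F\<^sup>2 = (P_fps (1 + z))\<^sup>2"
    by (simp only: mult_cancel_right simp_thms)
  moreover have "F $ 0 = 1"
    using has_fps_expansion_imp_0_eq_fps_nth_0[OF F] f0 by simp
  ultimately have "F = P_fps (1 + z)"
    by (rule fps_eq_if_square_eq) (simp add: P_fps_def)
  then show ?thesis
    using fps_nth_fps_expansion[OF F, of m] P_fps_nth[OF z, of m] by simp
qed

section \<open>Taylor coefficients near an inverse square root singularity\<close>

lemma norm_taylor_coeff_le:
  assumes hol: "K holomorphic_on ball 0 1" and bound: "\<And>u. u \<in> ball 0 1 \<Longrightarrow> norm (K u) \<le> C"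
  shows "norm ((deriv ^^ n) K 0 / fact n) \<le> C"
proof -
  let ?a = "norm ((deriv ^^ n) K 0 / fact n)"
  have "eventually (\<lambda>r. ?a * r ^ n \<le> C) (at_left (1::real))"
    using eventually_at_left_real[of 0 "1::real"]
  proof (rule eventually_mono)
    fix r :: real assume r: "r \<in> {0<..<1}"
    have "cball 0 r \<subseteq> ball (0::complex) 1" using r by auto
    then have "norm ((deriv ^^ n) K 0) \<le> fact n * C / r ^ n"
      using r by (intro Cauchy_inequality holomorphic_on_subset[OF hol]
          holomorphic_on_imp_continuous_on bound) auto
    then show "?a * r ^ n \<le> C"
      using r by (simp add: norm_divide field_simps)
  qed simp
  moreover have "((\<lambda>r. ?a * r ^ n) \<longlongrightarrow> ?a * 1 ^ n) (at_left 1)"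
    by (intro tendsto_intros)
  ultimately show ?thesis
    using tendsto_upperbound[of "\<lambda>r. ?a * r ^ n" "?a * 1 ^ n" "at_left 1" C] by simp
qed

text \<open>
  The telescoping majorant for the error sum in \<open>taylor_coeff_nonzero\<close>: the left-hand side is of the
  order \<open>n powr -2\<close>, which relative to \<open>central_coeff n\<close> is of the summable order \<open>n powr (-3/2)\<close>.
\<close>

lemma inverse_sqrt_step:
  assumes "n > 0"
  shows "1 / (real n * (2 * real n + 2)) \<le>
    3 * (1 / sqrt (real n) - 1 / sqrt (real (Suc n))) * central_coeff (Suc n)"
proof -
  define a b where "a = sqrt (real n)" and "b = sqrt (real (Suc n))"
  have pos: "a > 0" "b > 0" and squares: "real n = a * a" "real n + 1 = b * b"
    using assms by (auto simp: a_def b_def)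
  have "b \<le> 2 * a"
    using assms by - (rule power2_le_imp_le, auto simp: a_def b_def power_mult_distrib)
  then have "a + b \<le> 3 * a" by simp
  moreover have "(b - a) * (a + b) = 1" using squares by (simp add: algebra_simps)
  moreover have "a \<le> b" by (simp add: a_def b_def)
  ultimately have "1 \<le> 3 * a * (b - a)"
    using mult_left_mono[of "a + b" "3 * a" "b - a"] by (simp add: mult.commute)
  then have "1 / (a * a * (2 * (b * b))) \<le> 3 * a * (b - a) / (a * a * (2 * (b * b)))"
    using pos by (intro divide_right_mono) auto
  also have "\<dots> = 3 * (1 / a - 1 / b) * (1 / (2 * b))"
    using pos by (simp add: field_simps)
  also have "\<dots> \<le> 3 * (1 / a - 1 / b) * central_coeff (Suc n)"
    using central_coeff_lower[of "Suc n"] pos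
    by (intro mult_left_mono) (auto simp: a_def b_def field_simps)
  finally show ?thesis
    by (simp add: squares(2)[symmetric] a_def b_def algebra_simps)
qed

text \<open>
  The hypotheses say \<open>E = 2 * (1 - u) * f' - f\<close>, \<open>V = E'\<close> and \<open>K = 2 * (1 - u) * V' - V\<close>. On coefficients the operator
  is \<open>a n \<mapsto> 2 * (n + 1) * a (n + 1) - (2 * n + 1) * a n\<close>, which vanishes on \<open>central_coeff\<close>. The
  bound on \<open>K\<close> bounds its coefficients by Cauchy's inequality, then by induction those of \<open>V\<close>, so those of
  \<open>E\<close> are \<open>O(1/n)\<close>. Hence the ratio of the \<open>N\<close>-th coefficient of \<open>f\<close> to \<open>central_coeff N\<close> changes by at most
  \<open>3 * C / sqrt n\<close> over all \<open>N \<ge> n\<close>. If the \<open>n\<close>-th coefficient were 0, this ratio would stay below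
  that bound, contradicting the growth of \<open>f\<close> at 1 prescribed by \<open>b\<close>.
\<close>

lemma taylor_coeff_nonzero:
  fixes f E V K :: "complex \<Rightarrow> complex"
  assumes df: "\<And>u. u \<in> ball 0 1 \<Longrightarrow> (f has_field_derivative (f u + E u) / (2 * (1 - u))) (at u)"
    and dE: "\<And>u. u \<in> ball 0 1 \<Longrightarrow> (E has_field_derivative V u) (at u)"
    and dV: "\<And>u. u \<in> ball 0 1 \<Longrightarrow> (V has_field_derivative (V u + K u) / (2 * (1 - u))) (at u)"
    and K: "\<And>u. u \<in> ball 0 1 \<Longrightarrow> norm (K u) \<le> C"
    and V0: "norm (V 0) \<le> C"
    and lim: "((\<lambda>x. sqrt (1 - x) * norm (f (of_real x))) \<longlongrightarrow> b) (at_left 1)"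
    and n: "n > 0" "3 * C / sqrt (real n) < b"
  shows "(deriv ^^ n) f 0 / fact n \<noteq> 0"
proof
  assume zero: "(deriv ^^ n) f 0 / fact n = 0"
  have ne: "2 * (1 - u) \<noteq> 0" if "u \<in> ball 0 1" for u :: complex
    using that by auto
  have nhds: "eventually (\<lambda>u. u \<in> ball 0 1) (nhds (0::complex))"
    by (intro eventually_nhds_in_open) auto
  have hol: "f holomorphic_on ball 0 1" "E holomorphic_on ball 0 1" "V holomorphic_on ball 0 1"
    unfolding holomorphic_on_open[OF open_ball] using df dE dV by blast+
  have E_eq: "E u = 2 * (1 - u) * deriv f u - f u" if "u \<in> ball 0 1" for u
    using ne[OF that] by (simp add: DERIV_imp_deriv[OF df[OF that]])
  have V_eq: "V u = deriv E u" if "u \<in> ball 0 1" for u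
    by (simp add: DERIV_imp_deriv[OF dE[OF that]])
  have K_eq: "K u = 2 * (1 - u) * deriv V u - V u" if "u \<in> ball 0 1" for u
    using ne[OF that] by (simp add: DERIV_imp_deriv[OF dV[OF that]])
  have "(\<lambda>u. 2 * (1 - u) * deriv V u - V u) holomorphic_on ball 0 1"
    by (intro holomorphic_intros hol) auto
  then have holK: "K holomorphic_on ball 0 1"
    by (rule holomorphic_transform) (simp add: K_eq)
  define A where "A = fps_expansion f 0"
  have A: "f has_fps_expansion A"
    unfolding A_def by (rule has_fps_expansion_fps_expansion[OF _ _ hol(1)]) auto
  have expand_op: "g2 has_fps_expansion 2 * (1 - fps_X) * fps_deriv G - G"
    if "g has_fps_expansion G" "\<And>u. u \<in> ball 0 1 \<Longrightarrow> g2 u = 2 * (1 - u) * deriv g u - g u"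
    for g g2 :: "complex \<Rightarrow> complex" and G
  proof -
    have "(\<lambda>u. 2 * (1 - u) * deriv g u - g u) has_fps_expansion 2 * (1 - fps_X) * fps_deriv G - G"
      by (intro fps_expansion_intros that(1))
    moreover have "eventually (\<lambda>u. 2 * (1 - u) * deriv g u - g u = g2 u) (nhds 0)"
      using nhds by eventually_elim (simp add: that(2))
    note has_fps_expansion_cong[OF this refl]
    ultimately show ?thesis by (rule iffD1[rotated])
  qed
  have op_nth: "(2 * (1 - fps_X) * fps_deriv G - G) $ k =
      2 * (of_nat k + 1) * G $ Suc k - (2 * of_nat k + 1) * G $ k" for G :: "complex fps" and k
    by (cases k) (simp_all add: numeral_fps_const mult.assoc algebra_simps)
  define B where "B = 2 * (1 - fps_X) * fps_deriv A - A"
  have B: "E has_fps_expansion B"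
    unfolding B_def by (rule expand_op[OF A E_eq])
  define W where "W = fps_deriv B"
  have W: "V has_fps_expansion W"
  proof -
    have "deriv E has_fps_expansion W"
      unfolding W_def by (intro fps_expansion_intros B)
    moreover have "eventually (\<lambda>u. deriv E u = V u) (nhds 0)"
      using nhds by eventually_elim (simp add: V_eq)
    note has_fps_expansion_cong[OF this refl]
    ultimately show ?thesis by (rule iffD1[rotated])
  qed
  define L where "L = 2 * (1 - fps_X) * fps_deriv W - W"
  have L: "K has_fps_expansion L"
    unfolding L_def by (rule expand_op[OF W K_eq])
  have L_bound: "norm (L $ k) \<le> C" for k
    using norm_taylor_coeff_le[OF holK K] by (simp add: fps_nth_fps_expansion[OF L])
  have C: "C \<ge> 0" using V0 norm_ge_zero order.trans by blast

  have norm_step: "(2 * real k + 2) * norm x \<le> (2 * real k + 1) * norm y + norm z"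
    if "(2 * of_nat k + 2) * x = (2 * of_nat k + 1) * y + z" for k and x y z :: complex
  proof -
    have "norm (2 * of_nat k + 2 :: complex) = 2 * real k + 2" "norm (2 * of_nat k + 1 :: complex) = 2 * real k + 1"
      using norm_of_nat[of "2 * k + 2", where 'a = complex] norm_of_nat[of "2 * k + 1", where 'a = complex]
      by (simp_all add: add.commute)
    with that show ?thesis by (metis norm_mult norm_triangle_ineq)
  qed
  have W_bound: "norm (W $ k) \<le> C" for k
  proof (induction k)
    case 0
    then show ?case
      using V0 has_fps_expansion_imp_0_eq_fps_nth_0[OF W] by simp
  next
    case (Suc k)
    have "(2 * of_nat k + 2) * W $ Suc k = (2 * of_nat k + 1) * W $ k + L $ k"
      unfolding L_def op_nth by (simp add: algebra_simps)
    then have "(2 * real k + 2) * norm (W $ Suc k) \<le> (2 * real k + 1) * norm (W $ k) + norm (L $ k)"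
      by (rule norm_step)
    also have "\<dots> \<le> (2 * real k + 1) * C + C"
      by (intro add_mono mult_left_mono Suc.IH L_bound) auto
    also have "\<dots> = (2 * real k + 2) * C" by (simp add: algebra_simps)
    finally show ?case by (simp add: mult_le_cancel_left)
  qed
  have B_bound: "norm (B $ k) \<le> C / real k" if "k > 0" for k
  proof -
    obtain j where k: "k = Suc j" using \<open>k > 0\<close> by (cases k) auto
    have "norm (W $ j) = real k * norm (B $ k)"
      unfolding W_def k by (simp add: norm_mult del: of_nat_Suc)
    then show ?thesis
      using W_bound[of j] that by (simp add: field_simps)
  qed
  have A_n: "A $ n = 0" using zero by (simp add: fps_nth_fps_expansion[OF A])
  have A_bound: "norm (A $ N) \<le> 3 * C * (1 / sqrt (real n) - 1 / sqrt (real N)) * central_coeff N"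
    if "N \<ge> n" for N
    using that
  proof (induction N rule: dec_induct)
    case base
    then show ?case by (simp add: A_n)
  next
    case (step N)
    have N: "N > 0" using step.hyps n(1) by simp
    have "(2 * of_nat N + 2) * A $ Suc N = (2 * of_nat N + 1) * A $ N + B $ N"
      unfolding B_def op_nth by (simp add: algebra_simps)
    then have "(2 * real N + 2) * norm (A $ Suc N) \<le> (2 * real N + 1) * norm (A $ N) + norm (B $ N)"
      by (rule norm_step)
    also have "\<dots> \<le> (2 * real N + 1) * (3 * C * (1 / sqrt (real n) - 1 / sqrt (real N)) * central_coeff N) + C / real N"
      by (intro add_mono mult_left_mono step.IH B_bound N) auto
    finally have "norm (A $ Suc N) \<le>
        ((2 * real N + 1) * (3 * C * (1 / sqrt (real n) - 1 / sqrt (real N)) * central_coeff N) + C / real N) / (2 * real N + 2)"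
      by (simp add: pos_le_divide_eq mult.commute)
    also have "\<dots> = 3 * C * (1 / sqrt (real n) - 1 / sqrt (real N)) * central_coeff (Suc N)
        + C * (1 / (real N * (2 * real N + 2)))"
      unfolding central_coeff_Suc by (simp add: add_divide_distrib mult_ac)
    also have "\<dots> \<le> 3 * C * (1 / sqrt (real n) - 1 / sqrt (real N)) * central_coeff (Suc N)
        + C * (3 * (1 / sqrt (real N) - 1 / sqrt (real (Suc N))) * central_coeff (Suc N))"
      by (intro add_left_mono mult_left_mono inverse_sqrt_step N C)
    also have "\<dots> = 3 * C * (1 / sqrt (real n) - 1 / sqrt (real (Suc N))) * central_coeff (Suc N)"
      by (simp add: algebra_simps)
    finally show ?case .
  qed
  define \<kappa> where "\<kappa> = 3 * C / sqrt (real n)"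
  have A_bound': "norm (A $ N) \<le> \<kappa> * central_coeff N" if "N \<ge> n" for N
  proof -
    have "3 * C * (1 / sqrt (real n) - 1 / sqrt (real N)) \<le> \<kappa>"
      using C by (simp add: \<kappa>_def right_diff_distrib)
    then have "3 * C * (1 / sqrt (real n) - 1 / sqrt (real N)) * central_coeff N \<le> \<kappa> * central_coeff N"
      by (intro mult_right_mono less_imp_le[OF central_coeff_pos])
    with A_bound[OF that] show ?thesis by linarith
  qed
  have \<kappa>: "\<kappa> \<ge> 0" using C by (simp add: \<kappa>_def)
  \<comment> \<open>Compare \<open>f\<close> near 1 with \<open>\<kappa> / sqrt (1 - x)\<close>; the first \<open>n\<close> coefficients contribute only a bounded term.\<close>
  define M where "M = (\<Sum>k<n. norm (A $ k))"
  have "sqrt (1 - x) * norm (f (of_real x)) \<le> sqrt (1 - x) * M + \<kappa>" if x: "x \<in> {0<..<1}" for x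
  proof -
    have x': "of_real x \<in> ball (0::complex) 1" using x by simp
    have sums_f: "(\<lambda>k. A $ k * of_real x ^ k) sums f (of_real x)"
      using holomorphic_power_series[OF hol(1) x'] by (simp add: fps_nth_fps_expansion[OF A])
    have sums_M: "(\<lambda>k. if k \<in> {..<n} then norm (A $ k) else 0) sums M"
      unfolding M_def by (rule sums_If_finite_set) simp
    have sums_c: "(\<lambda>k. \<kappa> * (central_coeff k * x ^ k)) sums (\<kappa> * (1 / sqrt (1 - x)))"
      using x by (intro sums_mult central_coeff_sums) auto
    have "norm (f (of_real x)) \<le> M + \<kappa> * (1 / sqrt (1 - x))"
    proof -
      have "norm (\<Sum>k. A $ k * of_real x ^ k) \<le>
          (\<Sum>k. (if k \<in> {..<n} then norm (A $ k) else 0) + \<kappa> * (central_coeff k * x ^ k))"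
      proof (rule norm_suminf_le)
        show "summable (\<lambda>k. (if k \<in> {..<n} then norm (A $ k) else 0) + \<kappa> * (central_coeff k * x ^ k))"
          using sums_add[OF sums_M sums_c] by (rule sums_summable)
        fix k
        have "x ^ k \<le> 1" "x ^ k \<ge> 0" using x by (auto simp: power_le_one)
        show "norm (A $ k * of_real x ^ k) \<le> (if k \<in> {..<n} then norm (A $ k) else 0) + \<kappa> * (central_coeff k * x ^ k)"
        proof (cases "k < n")
          case True
          have "norm (A $ k) * x ^ k \<le> norm (A $ k)"
            using \<open>x ^ k \<le> 1\<close> by (simp add: mult_left_le)
          moreover have "0 \<le> \<kappa> * (central_coeff k * x ^ k)"
            using \<kappa> \<open>x ^ k \<ge> 0\<close> by (intro mult_nonneg_nonneg less_imp_le[OF central_coeff_pos])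
          ultimately show ?thesis
            using True x by (simp add: norm_mult norm_power)
        next
          case False
          then have "norm (A $ k) * x ^ k \<le> (\<kappa> * central_coeff k) * x ^ k"
            using \<open>x ^ k \<ge> 0\<close> by (intro mult_right_mono A_bound') auto
          then show ?thesis using False x by (simp add: norm_mult norm_power mult.assoc)
        qed
      qed
      then show ?thesis
        using sums_unique[OF sums_f] sums_unique[OF sums_add[OF sums_M sums_c]] by simp
    qed
    then have "sqrt (1 - x) * norm (f (of_real x)) \<le> sqrt (1 - x) * (M + \<kappa> * (1 / sqrt (1 - x)))"
      using x by (intro mult_left_mono) auto
    also have "\<dots> = sqrt (1 - x) * M + \<kappa>"
      using x by (simp add: distrib_left)
    finally show ?thesis .
  qed
  then have "eventually (\<lambda>x. sqrt (1 - x) * norm (f (of_real x)) \<le> sqrt (1 - x) * M + \<kappa>) (at_left 1)"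
    using eventually_at_left_real[of 0 "1::real"] by (auto elim: eventually_mono)
  moreover have "((\<lambda>x. sqrt (1 - x) * M + \<kappa>) \<longlongrightarrow> sqrt (1 - 1) * M + \<kappa>) (at_left 1)"
    by (intro tendsto_intros)
  ultimately have "b \<le> sqrt (1 - 1) * M + \<kappa>"
    using lim by (intro tendsto_le[of "at_left (1::real)"]) auto
  then show False using n(2) by (simp add: \<kappa>_def)
qed

section \<open>Points outside the left loop\<close>

lemma csqrt_1_minus_derivative:
  assumes "norm u < 1"
  shows "((\<lambda>u. csqrt (1 - u)) has_field_derivative - 1 / (2 * csqrt (1 - u))) (at u)"
proof -
  have "Re u < 1" using assms abs_Re_le_cmod[of u] by simp
  then have "1 - u \<notin> \<real>\<^sub>\<le>\<^sub>0" by (auto simp: complex_nonpos_Reals_iff)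
  then show ?thesis
    by (auto intro!: derivative_eq_intros simp: field_simps)
qed

text \<open>
  The generating function is \<open>\<beta> / (s * q)\<close> with \<open>s = sqrt (1 - u)\<close> and \<open>q\<^sup>2 = 1 + s / z\<close>. As \<open>z + s\<close> keeps away from
  0 on the unit disk, \<open>q\<close> exists as a holomorphic function there and is bounded below. In terms of
  \<open>h s = \<beta> / q\<close>, as a function of \<open>s\<close>, the functions of the criterion are \<open>E = - h'\<close>, \<open>V = h'' / (2 * s)\<close> and
  \<open>K = - h''' / 2\<close>: each application of the operator turns a function of the form \<open>h s / s\<close> into \<open>- h' s\<close>,
  so no singular factor survives in \<open>K\<close>. The lower bound on \<open>norm (1 + z)\<close> keeps \<open>norm \<beta>\<close>, the
  limit of \<open>norm (s * f)\<close> at \<open>u = 1\<close>, away from 0.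
\<close>

lemma P_nonzero_endpoint:
  assumes d: "d > 0" and far: "\<And>u. norm u < 1 \<Longrightarrow> d \<le> norm (z + csqrt (1 - u))"
    and z: "d \<le> norm z" "norm z \<le> 5 * norm (1 + z)"
    and n: "n > 0" "3 * (1 + 2 / d) ^ 11 / sqrt (real n) < 2 / 5"
  shows "poly (P n) z \<noteq> 0"
proof -
  \<comment> \<open>A common bound for \<open>1 / z\<close>, \<open>1 / q\<close> and \<open>\<beta>\<close>; eleven such factors occur in \<open>K\<close>.\<close>
  define M where "M = 1 + 2 / d"
  have M: "M \<ge> 1" using d by (simp add: M_def)
  define s where "s = (\<lambda>u. csqrt (1 - u))"
  have s2: "s u ^ 2 = 1 - u" for u by (simp add: s_def)
  have s_nz: "s u \<noteq> 0" if "norm u < 1" for u using that by (auto simp: s_def)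
  have ds: "(s has_field_derivative - 1 / (2 * s u)) (at u)" if "norm u < 1" for u
    unfolding s_def by (rule csqrt_1_minus_derivative[OF that])
  have s_norm: "norm (s u) \<le> 2" if "norm u < 1" for u
  proof (rule power2_le_imp_le)
    have "norm (s u) ^ 2 = norm (1 - u)" by (simp add: s2 flip: norm_power)
    also have "\<dots> \<le> 2" using that norm_triangle_ineq4[of 1 u] by simp
    finally show "norm (s u) ^ 2 \<le> 2\<^sup>2" by simp
  qed auto
  have z_nz: "z \<noteq> 0" using z d by auto
  then have z_nm1: "z \<noteq> -1" using z(2) by auto
  define \<zeta> where "\<zeta> = 1 / z"
  have \<zeta>: "norm \<zeta> \<le> 1 / d"
    using z(1) d unfolding \<zeta>_def by (simp add: norm_divide frac_le)
  then have \<zeta>_M: "norm \<zeta> \<le> M" using d by (simp add: M_def field_simps)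
  have eq: "1 + \<zeta> * s u = (z + s u) / z" for u
    using z_nz by (simp add: \<zeta>_def field_simps)
  have nz: "1 + \<zeta> * s u \<noteq> 0" if "u \<in> ball 0 1" for u
    using far[of u] that d z_nz unfolding eq by (auto simp: s_def)
  have "s holomorphic_on ball 0 1"
    unfolding holomorphic_on_open[OF open_ball] using ds mem_ball_0 by blast
  then have hol: "(\<lambda>u. 1 + \<zeta> * s u) holomorphic_on ball 0 1"
    by (intro holomorphic_intros)
  have "\<exists>q. q holomorphic_on ball 0 1 \<and> (\<forall>u\<in>ball 0 1. 1 + \<zeta> * s u = q u ^ 2)"
    by (rule contractible_imp_holomorphic_sqrt[OF hol convex_imp_contractible[OF convex_ball]])
       (use nz in blast)+
  then obtain q where q: "q holomorphic_on ball 0 1" "\<And>u. u \<in> ball 0 1 \<Longrightarrow> 1 + \<zeta> * s u = q u ^ 2"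
    by blast
  have q2: "q u ^ 2 = 1 + \<zeta> * s u" if "norm u < 1" for u using q(2)[of u] that by simp
  have q_nz: "q u \<noteq> 0" if "norm u < 1" for u using nz[of u] q2[OF that] that by auto
  have dq: "(q has_field_derivative - \<zeta> / (4 * s u * q u)) (at u)" if u: "norm u < 1" for u
  proof -
    obtain q' where q': "(q has_field_derivative q') (at u)"
      using q(1) u unfolding holomorphic_on_open[OF open_ball] mem_ball_0[symmetric] by blast
    have "((\<lambda>u. q u ^ 2) has_field_derivative 2 * q u * q') (at u)"
      by (auto intro!: derivative_eq_intros q')
    moreover have "((\<lambda>u. q u ^ 2) has_field_derivative \<zeta> * (- 1 / (2 * s u))) (at u)"
    proof (rule has_field_derivative_transform_within_open)
      show "((\<lambda>u. 1 + \<zeta> * s u) has_field_derivative \<zeta> * (- 1 / (2 * s u))) (at u)"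
        by (auto intro!: derivative_eq_intros ds u)
      show "open (ball (0::complex) 1)" "u \<in> ball 0 1" using u by auto
    qed (simp add: q2)
    ultimately have "2 * q u * q' = \<zeta> * (- 1 / (2 * s u))"
      by (rule DERIV_unique)
    then have "q' = - \<zeta> / (4 * s u * q u)"
      using q_nz[OF u] s_nz[OF u] by (simp add: field_simps)
    with q' show ?thesis by simp
  qed
  have q_inv: "norm (1 / q u) \<le> M" if u: "norm u < 1" for u
  proof (rule power2_le_imp_le)
    have "norm z \<le> norm (z + s u) + norm (s u)"
      using norm_triangle_ineq4[of "z + s u" "s u"] by simp
    also have "norm (s u) \<le> 2 / d * d" using d s_norm[OF u] by simp
    also have "2 / d * d \<le> 2 / d * norm (z + s u)"
      using far[OF u] d unfolding s_def by (intro mult_left_mono) auto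
    finally have "norm z \<le> M * norm (z + s u)"
      by (simp add: M_def algebra_simps)
    moreover have "norm (z + s u) > 0" using far[OF u] d unfolding s_def by linarith
    moreover have "norm (1 / q u) ^ 2 = norm z / norm (z + s u)"
    proof -
      have "norm (1 / q u) ^ 2 = 1 / norm (q u ^ 2)"
        by (simp add: norm_divide power_divide norm_power)
      then show ?thesis by (simp add: q2[OF u] eq norm_divide)
    qed
    ultimately have "norm (1 / q u) ^ 2 \<le> M" by (simp add: divide_le_eq)
    also have "M \<le> M\<^sup>2" using M by (simp add: power2_eq_square)
    finally show "norm (1 / q u) ^ 2 \<le> M\<^sup>2" .
  qed (use M in auto)
  \<comment> \<open>Normalises the generating function to have the value 1 at 0.\<close>
  define \<beta> where "\<beta> = q 0"
  have \<beta>2: "\<beta>\<^sup>2 = 1 + \<zeta>" using q2[of 0] by (simp add: \<beta>_def s_def)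
  have \<beta>_M: "norm \<beta> \<le> M"
  proof (rule power2_le_imp_le)
    have "norm \<beta> ^ 2 = norm (1 + \<zeta>)" by (simp add: \<beta>2 flip: norm_power)
    also have "\<dots> \<le> 1 + 1 / d" using norm_triangle_ineq[of 1 \<zeta>] \<zeta> by simp
    also have "\<dots> \<le> M" using d by (simp add: M_def field_simps)
    also have "M \<le> M\<^sup>2" using M by (simp add: power2_eq_square)
    finally show "norm \<beta> ^ 2 \<le> M\<^sup>2" .
  qed (use M in auto)
  define f where "f = (\<lambda>u. \<beta> / (s u * q u))"
  define E where "E = (\<lambda>u. \<zeta> * \<beta> / (2 * q u ^ 3))"
  define V where "V = (\<lambda>u. 3 * \<zeta>\<^sup>2 * \<beta> / (8 * s u * q u ^ 5))"
  define K where "K = (\<lambda>u. 15 * \<zeta> ^ 3 * \<beta> / (16 * q u ^ 7))"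
  have df: "(f has_field_derivative (f u + E u) / (2 * (1 - u))) (at u)" if "u \<in> ball 0 1" for u
  proof -
    have u: "norm u < 1" using that by simp
    show ?thesis
      unfolding f_def E_def s2[symmetric] using s_nz[OF u] q_nz[OF u]
      by (auto intro!: derivative_eq_intros ds dq u) (simp add: field_simps eval_nat_numeral)
  qed
  have dE: "(E has_field_derivative V u) (at u)" if "u \<in> ball 0 1" for u
  proof -
    have u: "norm u < 1" using that by simp
    show ?thesis
      unfolding E_def V_def using s_nz[OF u] q_nz[OF u]
      by (auto intro!: derivative_eq_intros ds dq u) (simp add: field_simps eval_nat_numeral)
  qed
  have dV: "(V has_field_derivative (V u + K u) / (2 * (1 - u))) (at u)" if "u \<in> ball 0 1" for u
  proof -
    have u: "norm u < 1" using that by simp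
    show ?thesis
      unfolding V_def K_def s2[symmetric] using s_nz[OF u] q_nz[OF u]
      by (auto intro!: derivative_eq_intros ds dq u) (simp add: field_simps eval_nat_numeral)
  qed
  have K_bound: "norm (K u) \<le> M ^ 11" if "u \<in> ball 0 1" for u
  proof -
    have "K u = 15 / 16 * (\<zeta> ^ 3 * \<beta> * (1 / q u) ^ 7)"
      by (simp add: K_def power_divide)
    then have "norm (K u) = 15 / 16 * (norm \<zeta> ^ 3 * norm \<beta> * norm (1 / q u) ^ 7)"
      by (simp only: norm_mult norm_power) simp
    also have "\<dots> \<le> 1 * (M ^ 3 * M * M ^ 7)"
      using that M by (intro mult_mono power_mono \<zeta>_M \<beta>_M q_inv) auto
    finally show ?thesis by (simp add: eval_nat_numeral mult_ac)
  qed
  have V_bound: "norm (V 0) \<le> M ^ 11"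
  proof -
    have "V 0 = 3 / 8 * (\<zeta> ^ 2 * \<beta> * (1 / q 0) ^ 5)"
      by (simp add: V_def s_def power_divide)
    then have "norm (V 0) = 3 / 8 * (norm \<zeta> ^ 2 * norm \<beta> * norm (1 / q 0) ^ 5)"
      by (simp only: norm_mult norm_power) simp
    also have "\<dots> \<le> 1 * (M ^ 2 * M * M ^ 5)"
      using M by (intro mult_mono power_mono \<zeta>_M \<beta>_M q_inv) auto
    also have "\<dots> = M ^ 8" by (simp add: eval_nat_numeral mult_ac)
    also have "\<dots> \<le> M ^ 11" using M by (intro power_increasing) auto
    finally show ?thesis .
  qed
  have lim: "((\<lambda>x. sqrt (1 - x) * norm (f (of_real x))) \<longlongrightarrow> norm \<beta>) (at_left 1)"
  proof -
    have "((\<lambda>x. norm \<beta> / sqrt (norm (1 + \<zeta> * of_real (sqrt (1 - x))))) \<longlongrightarrow>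
        norm \<beta> / sqrt (norm (1 + \<zeta> * of_real (sqrt (1 - 1))))) (at_left 1)"
      by (intro tendsto_intros) auto
    moreover have "eventually (\<lambda>x. sqrt (1 - x) * norm (f (of_real x)) =
        norm \<beta> / sqrt (norm (1 + \<zeta> * of_real (sqrt (1 - x))))) (at_left (1::real))"
      using eventually_at_left_real[of 0 "1::real"]
    proof (rule eventually_mono)
      fix x :: real assume x: "x \<in> {0<..<1}"
      have s_x: "s (of_real x) = of_real (sqrt (1 - x))"
        using x of_real_sqrt[of "1 - x"] by (simp add: s_def)
      have "norm (q (of_real x)) ^ 2 = norm (1 + \<zeta> * of_real (sqrt (1 - x)))"
        using x q2[of "of_real x"] by (simp add: s_x flip: norm_power)
      then have "norm (q (of_real x)) = sqrt (norm (1 + \<zeta> * of_real (sqrt (1 - x))))"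
        by (metis norm_ge_zero real_sqrt_unique)
      then show "sqrt (1 - x) * norm (f (of_real x)) = norm \<beta> / sqrt (norm (1 + \<zeta> * of_real (sqrt (1 - x))))"
        using x by (simp add: f_def s_x norm_divide norm_mult)
    qed simp
    ultimately show ?thesis
      using tendsto_cong by fastforce
  qed
  have \<beta>_lower: "2 / 5 \<le> norm \<beta>"
  proof (rule power2_le_imp_le)
    have "norm \<beta> ^ 2 = norm (1 + z) / norm z"
    proof -
      have "norm \<beta> ^ 2 = norm (1 + \<zeta>)" by (simp only: \<beta>2 flip: norm_power)
      also have "1 + \<zeta> = (1 + z) / z" using z_nz by (simp add: \<zeta>_def field_simps)
      finally show ?thesis by (simp only: norm_divide)
    qed
    also have "\<dots> \<ge> 1 / 5"
      using z z_nz by (simp add: field_simps)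
    finally show "(2 / 5)\<^sup>2 \<le> norm \<beta> ^ 2" by (simp add: power2_eq_square)
  qed auto
  have "(deriv ^^ n) f 0 / fact n \<noteq> 0"
  proof (rule taylor_coeff_nonzero[OF df dE dV K_bound V_bound lim n(1)])
    show "3 * M ^ 11 / sqrt (real n) < norm \<beta>"
      using n(2) \<beta>_lower unfolding M_def by linarith
  qed
  moreover have "(deriv ^^ n) f 0 / fact n = poly (P n) z / (2 * (1 + z)) ^ n"
  proof (rule generating_function_P[OF z_nm1])
    show "open (ball (0::complex) 1)" "(0::complex) \<in> ball 0 1" by auto
    show "f holomorphic_on ball 0 1"
      unfolding holomorphic_on_open[OF open_ball] using df by blast
    show "f 0 = 1" using q_nz[of 0] by (simp add: f_def \<beta>_def s_def)
    fix u :: complex assume "u \<in> ball 0 1"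
    then have u: "norm u < 1" by simp
    have "(f u)\<^sup>2 = (1 + \<zeta>) / ((1 - u) * ((z + s u) / z))"
      by (simp add: f_def power_divide power_mult_distrib \<beta>2 s2 q2[OF u] eq)
    also have "\<dots> * ((1 - u) * (z + s u)) = 1 + z"
    proof -
      have "1 - u \<noteq> 0" "z + s u \<noteq> 0" using u far[OF u] d by (auto simp: s_def)
      then have "(1 + \<zeta>) / ((1 - u) * ((z + s u) / z)) * ((1 - u) * (z + s u)) = (1 + \<zeta>) * z"
        by simp
      then show ?thesis using z_nz by (simp add: \<zeta>_def distrib_right)
    qed
    finally show "(f u)\<^sup>2 * ((1 - u) * (z + csqrt (1 - u))) = 1 + z"
      by (simp add: s_def)
  qed
  ultimately show ?thesis by auto
qed

section \<open>Points inside the left loop\<close>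

text \<open>
  With \<open>u = \<mu> * t\<close>, \<open>\<mu> = 1 - z\<^sup>2\<close>, the identity \<open>(s - z) * (s + z) = \<mu> * (1 - t)\<close> moves the zero of \<open>z + s\<close> into an
  explicit factor: the generating function becomes \<open>G t / sqrt (1 - t)\<close>, where \<open>G\<close> involves only \<open>sqrt (s - z)\<close>
  and \<open>1 / s\<close> and so is holomorphic and bounded on the disk of radius \<open>1 + \<eta>\<close>. Here \<open>Re z < 0\<close> is used to keep
  \<open>s - z\<close> in the right half-plane. Cauchy's inequality on disks of radius \<open>\<eta> / 2\<close> bounds the first three
  derivatives of \<open>G\<close>, which is all that enters the functions of the criterion. The point \<open>z = -1\<close>, where the
  scaling degenerates, is excluded.
\<close>

lemma P_nonzero_saddle:
  assumes \<eta>: "0 < \<eta>" and z: "norm (1 - z\<^sup>2) \<le> 1 - 3 * \<eta>" "Re z < 0" "z \<noteq> -1"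
    and n: "n > 0" "3 * (5000 / \<eta> ^ 4) / sqrt (real n) < 2 / 5"
  shows "poly (P n) z \<noteq> 0"
proof -
  define \<mu> where "\<mu> = 1 - z\<^sup>2"
  have \<mu>_factor: "\<mu> = (1 - z) * (1 + z)" by (simp add: \<mu>_def power2_eq_square algebra_simps)
  have z_nz: "1 - z \<noteq> 0" "1 + z \<noteq> 0" "z \<noteq> 0" using z(2,3) by (auto simp: add_eq_0_iff)
  then have \<mu>_nz: "\<mu> \<noteq> 0" by (simp add: \<mu>_factor)
  have \<eta>_lt: "\<eta> \<le> 1 / 3" using order.trans[OF norm_ge_zero z(1)] by simp
  have \<mu>_norm: "norm \<mu> * (1 + \<eta>) \<le> 1 - 2 * \<eta>"
  proof -
    have "norm \<mu> * (1 + \<eta>) \<le> (1 - 3 * \<eta>) * (1 + \<eta>)"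
      using z(1) \<eta> by (intro mult_right_mono) (auto simp: \<mu>_def)
    also have "\<dots> \<le> 1 - 2 * \<eta>" using \<eta> by (simp add: algebra_simps)
    finally show ?thesis .
  qed
  have z_norm: "norm z \<le> 3 / 2"
  proof (rule power2_le_imp_le)
    have "norm z ^ 2 = norm (1 - \<mu>)" by (simp add: \<mu>_def flip: norm_power)
    also have "\<dots> \<le> 1 + norm \<mu>" using norm_triangle_ineq4[of 1 \<mu>] by simp
    also have "\<dots> \<le> (3 / 2)\<^sup>2" using z(1) \<eta> by (simp add: \<mu>_def power2_eq_square)
    finally show "norm z ^ 2 \<le> (3 / 2)\<^sup>2" .
  qed auto
  have one_minus_z: "1 \<le> norm (1 - z)" "norm (1 - z) \<le> 5 / 2"
    using abs_Re_le_cmod[of "1 - z"] z(2) norm_triangle_ineq4[of 1 z] z_norm by auto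

  define s where "s = (\<lambda>t. csqrt (1 - \<mu> * t))"
  define G where "G = (\<lambda>t. csqrt (s t - z) / (s t * csqrt (1 - z)))"
  have small: "norm (\<mu> * t) \<le> 1 - 2 * \<eta>" if "norm t < 1 + \<eta>" for t
  proof -
    have "norm (\<mu> * t) \<le> norm \<mu> * (1 + \<eta>)"
      using that by (auto simp: norm_mult intro!: mult_left_mono)
    with \<mu>_norm show ?thesis by linarith
  qed
  have s2: "s t ^ 2 = 1 - \<mu> * t" for t by (simp add: s_def)
  have norm_s2: "norm (s t) ^ 2 = norm (1 - \<mu> * t)" for t
    by (simp add: s2 flip: norm_power)
  have s_lower: "\<eta> \<le> norm (s t) ^ 2" if "norm t < 1 + \<eta>" for t
    using small[OF that] norm_triangle_ineq2[of 1 "\<mu> * t"] \<eta> unfolding norm_s2 norm_one by linarith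
  have s_upper: "norm (s t) \<le> 3 / 2" if "norm t < 1 + \<eta>" for t
  proof (rule power2_le_imp_le)
    have "norm (s t) ^ 2 \<le> 2"
      using small[OF that] norm_triangle_ineq4[of 1 "\<mu> * t"] \<eta> unfolding norm_s2 norm_one by linarith
    also have "(2::real) \<le> (3 / 2)\<^sup>2" by (simp add: power2_eq_square)
    finally show "norm (s t) ^ 2 \<le> (3 / 2)\<^sup>2" .
  qed auto
  have s_nz: "s t \<noteq> 0" if "norm t < 1 + \<eta>" for t
    using s_lower[OF that] \<eta> by auto
  have Re_pos: "Re (1 - \<mu> * t) > 0" if "norm t < 1 + \<eta>" for t
    using small[OF that] abs_Re_le_cmod[of "\<mu> * t"] \<eta> by simp
  have s_hol: "s holomorphic_on ball 0 (1 + \<eta>)"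
    unfolding s_def
  proof (intro holomorphic_intros)
    fix t :: complex assume "t \<in> ball 0 (1 + \<eta>)"
    then show "1 - \<mu> * t \<notin> \<real>\<^sub>\<le>\<^sub>0"
      using Re_pos[of t] unfolding complex_nonpos_Reals_iff mem_ball_0 by linarith
  qed
  have Re_sz: "Re (s t - z) > 0" for t
    using csqrt_principal[of "1 - \<mu> * t"] z(2) unfolding s_def minus_complex.sel by linarith
  have G_hol: "G holomorphic_on ball 0 (1 + \<eta>)"
    unfolding G_def
  proof (intro holomorphic_intros s_hol)
    fix t :: complex assume "t \<in> ball 0 (1 + \<eta>)"
    then show "s t * csqrt (1 - z) \<noteq> 0" using s_nz[of t] z_nz by simp
    show "s t - z \<notin> \<real>\<^sub>\<le>\<^sub>0" using Re_sz[of t] unfolding complex_nonpos_Reals_iff by linarith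
  qed
  have G2: "(G t)\<^sup>2 = (s t - z) / ((1 - \<mu> * t) * (1 - z))" for t
    by (simp add: G_def power_divide power_mult_distrib s2)
  have G_bound: "norm (G t) \<le> 2 / \<eta>" if t: "norm t < 1 + \<eta>" for t
  proof (rule power2_le_imp_le)
    have "norm (G t) ^ 2 = norm (s t - z) / (norm (s t) ^ 2 * norm (1 - z))"
      by (simp only: G2 s2 norm_divide norm_mult norm_power[symmetric])
    also have "\<dots> \<le> 3 / (\<eta> * 1)"
    proof (rule frac_le)
      show "norm (s t - z) \<le> 3"
        using norm_triangle_ineq4[of "s t" z] s_upper[OF t] z_norm by simp
      show "\<eta> * 1 \<le> norm (s t) ^ 2 * norm (1 - z)"
        using \<eta> by (intro mult_mono s_lower t one_minus_z) auto
    qed (use \<eta> in auto)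
    also have "\<dots> \<le> (2 / \<eta>)\<^sup>2"
      using \<eta> \<eta>_lt by (simp add: power2_eq_square field_simps)
    finally show "norm (G t) ^ 2 \<le> (2 / \<eta>)\<^sup>2" .
  qed (use \<eta> in auto)
  define D1 D2 D3 where "D1 = deriv G" and "D2 = deriv D1" and "D3 = deriv D2"
  have hol: "D1 holomorphic_on ball 0 (1 + \<eta>)" "D2 holomorphic_on ball 0 (1 + \<eta>)"
    unfolding D1_def D2_def by (auto intro!: holomorphic_deriv G_hol)
  have in_ball: "t \<in> ball 0 (1 + \<eta>)" if "norm t < 1" for t :: complex
    using that \<eta> by simp
  have dG: "(G has_field_derivative D1 t) (at t)" "(D1 has_field_derivative D2 t) (at t)"
      "(D2 has_field_derivative D3 t) (at t)" if "norm t < 1" for t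
    using holomorphic_derivI[OF G_hol open_ball in_ball[OF that], of UNIV]
      holomorphic_derivI[OF hol(1) open_ball in_ball[OF that], of UNIV]
      holomorphic_derivI[OF hol(2) open_ball in_ball[OF that], of UNIV]
    by (simp_all add: D1_def D2_def D3_def)
  have cauchy: "norm ((deriv ^^ k) G t) \<le> fact k * (2 / \<eta>) / (\<eta> / 2) ^ k" if t: "norm t < 1" for k t
  proof -
    have sub: "cball t (\<eta> / 2) \<subseteq> ball 0 (1 + \<eta>)"
    proof
      fix w assume "w \<in> cball t (\<eta> / 2)"
      then have "norm (w - t) \<le> \<eta> / 2" by (simp add: dist_norm norm_minus_commute)
      then show "w \<in> ball 0 (1 + \<eta>)"
        using norm_triangle_ineq[of "w - t" t] t \<eta> by simp
    qed
    show ?thesis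
    proof (rule Cauchy_inequality)
      show "G holomorphic_on ball t (\<eta> / 2)"
        using sub by (intro holomorphic_on_subset[OF G_hol]) auto
      show "continuous_on (cball t (\<eta> / 2)) G"
        by (intro holomorphic_on_imp_continuous_on holomorphic_on_subset[OF G_hol] sub)
      fix w assume "norm (t - w) = \<eta> / 2"
      then have "w \<in> ball 0 (1 + \<eta>)" using sub by (auto simp: dist_norm)
      then show "norm (G w) \<le> 2 / \<eta>" by (intro G_bound) simp
    qed (use \<eta> in auto)
  qed
  \<comment> \<open>The bound \<open>fact k * (2 / \<eta>) / (\<eta> / 2) ^ k\<close> at \<open>k = 3\<close>, which is the largest one as \<open>\<eta> \<le> 1/3\<close>.\<close>
  define B where "B = 96 / \<eta> ^ 4"
  have G_bounds: "norm (D1 t) \<le> B" "norm (D2 t) \<le> B" "norm (D3 t) \<le> B" if "norm t < 1" for t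
  proof -
    have "fact k * (2 / \<eta>) / (\<eta> / 2) ^ k \<le> B" if "k \<in> {1, 2, 3}" for k :: nat
    proof -
      have "(2 / \<eta>) ^ k \<le> (2 / \<eta>) ^ 3"
        using \<eta> \<eta>_lt that by (intro power_increasing) (auto simp: field_simps)
      moreover have "(fact k :: real) \<le> 6" using that by (auto simp: fact_numeral)
      ultimately have "fact k * (2 / \<eta>) * (2 / \<eta>) ^ k \<le> 6 * (2 / \<eta>) * (2 / \<eta>) ^ 3"
        using \<eta> by (intro mult_mono) auto
      then show ?thesis
        using \<eta> by (simp add: B_def power_divide eval_nat_numeral field_simps)
    qed
    from this[of 1] this[of 2] this[of 3] cauchy[OF that, of 1] cauchy[OF that, of 2] cauchy[OF that, of 3]
    show "norm (D1 t) \<le> B" "norm (D2 t) \<le> B" "norm (D3 t) \<le> B"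
      by (simp_all add: D1_def D2_def D3_def eval_nat_numeral)
  qed

  define \<sigma> where "\<sigma> = (\<lambda>t::complex. csqrt (1 - t))"
  have \<sigma>2: "\<sigma> t ^ 2 = 1 - t" for t by (simp add: \<sigma>_def)
  have \<sigma>_nz: "\<sigma> t \<noteq> 0" if "norm t < 1" for t using that by (auto simp: \<sigma>_def)
  have d\<sigma>: "(\<sigma> has_field_derivative - 1 / (2 * \<sigma> t)) (at t)" if "norm t < 1" for t
    unfolding \<sigma>_def by (rule csqrt_1_minus_derivative[OF that])
  have \<sigma>_norm: "norm (\<sigma> t) \<le> 2" if "norm t < 1" for t
  proof (rule power2_le_imp_le)
    have "norm (\<sigma> t) ^ 2 = norm (1 - t)" by (simp add: \<sigma>2 flip: norm_power)
    also have "\<dots> \<le> 2" using that norm_triangle_ineq4[of 1 t] by simp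
    finally show "norm (\<sigma> t) ^ 2 \<le> 2\<^sup>2" by simp
  qed auto
  define f where "f = (\<lambda>t. G t / \<sigma> t)"
  define E where "E = (\<lambda>t. 2 * \<sigma> t * D1 t)"
  define V where "V = (\<lambda>t. 2 * \<sigma> t * D2 t - D1 t / \<sigma> t)"
  define K where "K = (\<lambda>t. 4 * \<sigma> t ^ 3 * D3 t - 6 * \<sigma> t * D2 t)"
  have df: "(f has_field_derivative (f t + E t) / (2 * (1 - t))) (at t)" if "t \<in> ball 0 1" for t
  proof -
    have t: "norm t < 1" using that by simp
    show ?thesis
      unfolding f_def E_def \<sigma>2[symmetric] using \<sigma>_nz[OF t]
      by (auto intro!: derivative_eq_intros d\<sigma> dG t) (simp add: field_simps eval_nat_numeral)
  qed
  have dE: "(E has_field_derivative V t) (at t)" if "t \<in> ball 0 1" for t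
  proof -
    have t: "norm t < 1" using that by simp
    show ?thesis
      unfolding E_def V_def using \<sigma>_nz[OF t]
      by (auto intro!: derivative_eq_intros d\<sigma> dG t)
  qed
  have dV: "(V has_field_derivative (V t + K t) / (2 * (1 - t))) (at t)" if "t \<in> ball 0 1" for t
  proof -
    have t: "norm t < 1" using that by simp
    show ?thesis
      unfolding V_def K_def \<sigma>2[symmetric] using \<sigma>_nz[OF t]
      by (auto intro!: derivative_eq_intros d\<sigma> dG t) (simp add: field_simps eval_nat_numeral)
  qed
  have B_pos: "B \<ge> 0" using \<eta> by (simp add: B_def)
  \<comment> \<open>The factor is \<open>4 * 2 ^ 3 + 6 * 2 = 44\<close>, from \<open>norm (\<sigma> t) \<le> 2\<close> in the estimate of \<open>K\<close>.\<close>
  have C: "44 * B \<le> 5000 / \<eta> ^ 4" using \<eta> by (simp add: B_def field_simps)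
  have K_bound: "norm (K t) \<le> 5000 / \<eta> ^ 4" if "t \<in> ball 0 1" for t
  proof -
    have t: "norm t < 1" using that by simp
    have "norm (K t) \<le> 4 * norm (\<sigma> t) ^ 3 * norm (D3 t) + 6 * norm (\<sigma> t) * norm (D2 t)"
      unfolding K_def using norm_triangle_ineq4[of "4 * \<sigma> t ^ 3 * D3 t" "6 * \<sigma> t * D2 t"]
      by (simp add: norm_mult norm_power)
    also have "\<dots> \<le> 4 * 2 ^ 3 * B + 6 * 2 * B"
      using B_pos by (intro add_mono mult_mono power_mono \<sigma>_norm G_bounds t) auto
    also have "\<dots> \<le> 5000 / \<eta> ^ 4" using C by simp
    finally show ?thesis .
  qed
  have V_bound: "norm (V 0) \<le> 5000 / \<eta> ^ 4"
  proof -
    have "norm (V 0) \<le> 2 * norm (D2 0) + norm (D1 0)"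
      unfolding V_def \<sigma>_def using norm_triangle_ineq4[of "2 * D2 0" "D1 0"] by (simp add: norm_mult)
    also have "\<dots> \<le> 2 * B + B" by (intro add_mono mult_left_mono G_bounds) auto
    also have "\<dots> \<le> 5000 / \<eta> ^ 4" using C B_pos by simp
    finally show ?thesis .
  qed
  have lim: "((\<lambda>x. sqrt (1 - x) * norm (f (of_real x))) \<longlongrightarrow> norm (G 1)) (at_left 1)"
  proof -
    have "isCont G 1"
      using holomorphic_on_imp_continuous_on[OF G_hol] \<eta> by (simp add: continuous_on_eq_continuous_at)
    then have "isCont G (of_real 1)" by simp
    moreover have "((\<lambda>x. of_real x :: complex) \<longlongrightarrow> of_real 1) (at_left (1::real))"
      by (intro tendsto_intros)
    ultimately have "((\<lambda>x. norm (G (of_real x))) \<longlongrightarrow> norm (G (of_real 1))) (at_left (1::real))"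
      by (intro tendsto_norm isCont_tendsto_compose[where g = G])
    moreover have "eventually (\<lambda>x. norm (G (of_real x)) = sqrt (1 - x) * norm (f (of_real x))) (at_left (1::real))"
      using eventually_at_left_real[of 0 "1::real"]
    proof (rule eventually_mono)
      fix x :: real assume x: "x \<in> {0<..<1}"
      have "\<sigma> (of_real x) = of_real (sqrt (1 - x))"
        using x of_real_sqrt[of "1 - x"] by (simp add: \<sigma>_def)
      then show "norm (G (of_real x)) = sqrt (1 - x) * norm (f (of_real x))"
        using x by (simp add: f_def norm_divide)
    qed simp
    ultimately show ?thesis
      using Lim_transform_eventually by fastforce
  qed
  have G_at_1_lower: "2 / 5 \<le> norm (G 1)"
  proof (rule power2_le_imp_le)
    have "s 1 = csqrt ((- z)\<^sup>2)" by (simp add: s_def \<mu>_def)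
    also have "\<dots> = - z" using z(2) by (intro csqrt_square) simp
    finally have "(G 1)\<^sup>2 = - 2 * z / (z\<^sup>2 * (1 - z))"
      by (simp add: G2 \<mu>_def)
    also have "\<dots> = - 2 / (z * (1 - z))"
      using z_nz by (simp add: power2_eq_square)
    finally have "norm ((G 1)\<^sup>2) = 2 / (norm z * norm (1 - z))"
      by (simp add: norm_divide norm_mult)
    then have "norm (G 1) ^ 2 = 2 / (norm z * norm (1 - z))"
      by (simp only: norm_power)
    also have "\<dots> \<ge> 2 / (3 / 2 * (5 / 2))"
      using z_norm one_minus_z z_nz by (intro divide_left_mono mult_mono) auto
    finally show "(2 / 5)\<^sup>2 \<le> norm (G 1) ^ 2" by (simp add: power2_eq_square)
  qed auto
  have coeff_nz: "(deriv ^^ n) f 0 / fact n \<noteq> 0"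
  proof (rule taylor_coeff_nonzero[OF df dE dV K_bound V_bound lim n(1)])
    show "3 * (5000 / \<eta> ^ 4) / sqrt (real n) < norm (G 1)"
      using n(2) G_at_1_lower by linarith
  qed
  have f_hol: "f holomorphic_on ball 0 1"
    unfolding holomorphic_on_open[OF open_ball] using df by blast
  \<comment> \<open>Undo the rescaling, to return to the variable of \<open>generating_function_P\<close>.\<close>
  define g where "g = (\<lambda>u. f (1 / \<mu> * u))"
  have scale: "1 / \<mu> * u \<in> ball 0 1" if "u \<in> ball 0 (norm \<mu>)" for u
    using that \<mu>_nz by (simp add: norm_divide)
  have "(deriv ^^ n) g 0 = (1 / \<mu>) ^ n * (deriv ^^ n) f (1 / \<mu> * 0)"
    unfolding g_def
    by (rule higher_deriv_compose_linear[OF f_hol open_ball[of 0 "norm \<mu>"] open_ball _ scale])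
       (use \<mu>_nz in auto)
  then have "(deriv ^^ n) g 0 / fact n \<noteq> 0"
    using coeff_nz \<mu>_nz by simp
  moreover have "(deriv ^^ n) g 0 / fact n = poly (P n) z / (2 * (1 + z)) ^ n"
  proof (rule generating_function_P[OF z(3)])
    show "open (ball (0::complex) (norm \<mu>))" "(0::complex) \<in> ball 0 (norm \<mu>)" using \<mu>_nz by auto
    show "g holomorphic_on ball 0 (norm \<mu>)"
      unfolding g_def
      by (rule holomorphic_on_compose_gen[OF _ f_hol, unfolded o_def])
         (use scale in \<open>auto intro!: holomorphic_intros simp: \<mu>_nz\<close>)
    show "g 0 = 1" using z_nz by (simp add: g_def f_def G_def s_def \<sigma>_def)
    fix u :: complex assume u: "u \<in> ball 0 (norm \<mu>)"
    define t where "t = 1 / \<mu> * u"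
    have t: "norm t < 1" using scale[OF u] by (simp add: t_def)
    have u_eq: "u = \<mu> * t" using \<mu>_nz by (simp add: t_def)
    have "g u = G t / \<sigma> t" by (simp only: g_def f_def t_def)
    then have "(g u)\<^sup>2 = (s t - z) / ((1 - u) * (1 - z)) / (1 - t)"
      by (simp only: power_divide G2 \<sigma>2 u_eq)
    moreover have "csqrt (1 - u) = s t" by (simp add: s_def u_eq)
    moreover have "1 - u \<noteq> 0"
      using s_nz[of t] s2[of t] t \<eta> by (auto simp: u_eq)
    ultimately have "(g u)\<^sup>2 * ((1 - u) * (z + csqrt (1 - u))) = (s t - z) * (s t + z) / (1 - z) / (1 - t)"
      by (simp add: add.commute)
    also have "(s t - z) * (s t + z) = \<mu> * (1 - t)"
      using s2[of t] by (simp add: power2_eq_square algebra_simps \<mu>_def)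
    also have "\<mu> * (1 - t) / (1 - z) / (1 - t) = \<mu> / (1 - z)"
      using t by auto
    also have "\<dots> = 1 + z" using z_nz by (simp add: \<mu>_factor)
    finally show "(g u)\<^sup>2 * ((1 - u) * (z + csqrt (1 - u))) = 1 + z" .
  qed
  ultimately show ?thesis by auto
qed

section \<open>Distance to the lemniscate\<close>

lemma lemniscate_minus: "z \<in> lemniscate \<Longrightarrow> - z \<in> lemniscate"
  by (simp add: lemniscate_def)

text \<open>
  For \<open>u\<close> in the unit disk, \<open>sqrt (1 - u)\<close> lies inside the right loop of the lemniscate, whereas \<open>-z\<close> does not.
  So the segment between them meets the lemniscate, and by symmetry the distance of \<open>z\<close> to it is at most
  the length of the segment.
\<close>

lemma far_from_right_lobe:
  assumes far: "\<delta> \<le> infdist z lemniscate"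
    and outside: "1 \<le> norm (1 - z\<^sup>2) \<or> 0 \<le> Re z"
    and u: "norm u < 1"
  shows "\<delta> \<le> norm (z + csqrt (1 - u))"
proof -
  define s where "s = csqrt (1 - u)"
  define p where "p = (\<lambda>t::real. s - of_real t * (z + s))"
  have "Re (1 - u) > 0" using u abs_Re_le_cmod[of u] by simp
  then have Re_s: "Re s > 0"
    using csqrt_principal[of "1 - u"] power2_csqrt[of "1 - u"]
    by (auto simp: s_def simp del: csqrt.sel power2_csqrt) (simp add: complex_eq_iff power2_eq_square)
  have "\<exists>t\<in>{0..1}. 1 \<le> norm (1 - (p t)\<^sup>2)"
    using outside
  proof
    assume "1 \<le> norm (1 - z\<^sup>2)"
    then show ?thesis by (intro bexI[of _ 1]) (auto simp: p_def)
  next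
    assume Re_z: "0 \<le> Re z"
    \<comment> \<open>Here \<open>- z\<close> is in the closed left half-plane; on the imaginary axis \<open>1 - p\<^sup>2\<close> has real part at least 1.\<close>
    define t where "t = Re s / (Re s + Re z)"
    have "t * (Re s + Re z) = Re s"
      using Re_s Re_z by (simp add: t_def)
    then have "Re (p t) = 0"
      by (simp add: p_def add.commute)
    then have "Re (1 - (p t)\<^sup>2) \<ge> 1" by (simp add: power2_eq_square)
    then have "1 \<le> norm (1 - (p t)\<^sup>2)"
      using complex_Re_le_cmod[of "1 - (p t)\<^sup>2"] by linarith
    moreover have "t \<in> {0..1}" using Re_s Re_z by (simp add: t_def)
    ultimately show ?thesis by blast
  qed
  then obtain t\<^sub>0 where t\<^sub>0: "0 \<le> t\<^sub>0" "t\<^sub>0 \<le> 1" "1 \<le> norm (1 - (p t\<^sub>0)\<^sup>2)" by auto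
  moreover have "norm (1 - (p 0)\<^sup>2) \<le> 1" using u by (simp add: p_def s_def)
  moreover have "continuous_on {0..t\<^sub>0} (\<lambda>t. norm (1 - (p t)\<^sup>2))"
    unfolding p_def by (intro continuous_intros)
  ultimately obtain t where t: "0 \<le> t" "t \<le> t\<^sub>0" "norm (1 - (p t)\<^sup>2) = 1"
    using IVT'[of "\<lambda>t. norm (1 - (p t)\<^sup>2)" 0 1 t\<^sub>0] by blast
  then have "- p t \<in> lemniscate"
    by (intro lemniscate_minus) (simp add: lemniscate_def)
  then have "infdist z lemniscate \<le> dist z (- p t)"
    by (rule infdist_le)
  also have "dist z (- p t) = norm (of_real (1 - t) * (z + s))"
    by (simp add: dist_norm p_def algebra_simps)
  also have "\<dots> = (1 - t) * norm (z + s)"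
    using t t\<^sub>0 by (subst norm_mult, subst norm_of_real) simp
  also have "\<dots> \<le> norm (z + s)"
    using t by (intro mult_left_le_one_le) (use t\<^sub>0 in auto)
  finally show ?thesis using far by (simp add: s_def)
qed

text \<open>
  The points inside the lemniscate at distance at least \<open>\<delta>\<close> from it form a compact set, on which
  \<open>norm (1 - z\<^sup>2)\<close> attains its maximum.
\<close>

lemma uniformly_inside_lemniscate:
  assumes "\<delta> > 0"
  obtains \<eta> where "\<eta> > 0"
    "\<And>z. \<delta> \<le> infdist z lemniscate \<Longrightarrow> norm (1 - z\<^sup>2) \<le> 1 \<Longrightarrow> norm (1 - z\<^sup>2) \<le> 1 - 3 * \<eta>"
proof -
  define S where "S = {z. \<delta> \<le> infdist z lemniscate \<and> norm (1 - z\<^sup>2) \<le> 1}"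
  have "S = {z. \<delta> \<le> infdist z lemniscate} \<inter> {z. norm (1 - z\<^sup>2) \<le> 1}"
    by (auto simp: S_def)
  moreover have "closed {z. \<delta> \<le> infdist z lemniscate}" "closed {z::complex. norm (1 - z\<^sup>2) \<le> 1}"
    by (intro closed_Collect_le continuous_intros)+
  ultimately have "closed S" by (simp add: closed_Int)
  moreover have "bounded S"
  proof (rule boundedI)
    fix z assume "z \<in> S"
    then have "norm (z\<^sup>2) \<le> 2"
      using norm_triangle_ineq2[of "z\<^sup>2" 1] norm_minus_commute[of "z\<^sup>2" 1] by (simp add: S_def)
    then have "norm z ^ 2 \<le> 2\<^sup>2" by (simp add: norm_power)
    then show "norm z \<le> 2" by (rule power2_le_imp_le) simp
  qed
  ultimately have "compact S" by (simp add: compact_eq_bounded_closed)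
  show ?thesis
  proof (cases "S = {}")
    case True
    then show ?thesis by (intro that[of 1]) (auto simp: S_def)
  next
    case False
    have "continuous_on S (\<lambda>z. norm (1 - z\<^sup>2))" by (intro continuous_intros)
    from continuous_attains_sup[OF \<open>compact S\<close> False this] obtain z\<^sub>0 where
      z\<^sub>0: "z\<^sub>0 \<in> S" "\<And>z. z \<in> S \<Longrightarrow> norm (1 - z\<^sup>2) \<le> norm (1 - z\<^sub>0\<^sup>2)"
      by blast
    have "z\<^sub>0 \<notin> lemniscate" using z\<^sub>0(1) assms by (auto simp: S_def)
    with z\<^sub>0(1) have "norm (1 - z\<^sub>0\<^sup>2) < 1" by (auto simp: S_def lemniscate_def)
    show ?thesis
    proof (rule that)
      show "(1 - norm (1 - z\<^sub>0\<^sup>2)) / 3 > 0"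
        using \<open>norm (1 - z\<^sub>0\<^sup>2) < 1\<close> by simp
      fix z assume "\<delta> \<le> infdist z lemniscate" "norm (1 - z\<^sup>2) \<le> 1"
      then have "norm (1 - z\<^sup>2) \<le> norm (1 - z\<^sub>0\<^sup>2)"
        by (intro z\<^sub>0(2)) (simp add: S_def)
      then show "norm (1 - z\<^sup>2) \<le> 1 - 3 * ((1 - norm (1 - z\<^sub>0\<^sup>2)) / 3)"
        by (simp add: field_simps)
    qed
  qed
qed

section \<open>Convergence of the zeros\<close>

lemma eventually_const_over_sqrt_less:
  assumes "(e::real) > 0"
  shows "eventually (\<lambda>n. c / sqrt (real n) < e) sequentially"
proof -
  have "(\<lambda>n. c / sqrt (real n)) \<longlonglongrightarrow> 0"
    by real_asymp
  then show ?thesis using assms by (rule order_tendstoD)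
qed

text \<open>
  The plane is divided into the inside of the left loop, with its centre \<open>-1\<close> where the value of \<open>P m\<close>
  is known, and the rest.
\<close>

lemma eventually_P_nonzero_off_lemniscate:
  assumes \<delta>: "\<delta> > 0"
  shows "eventually (\<lambda>m. \<forall>z. \<delta> \<le> infdist z lemniscate \<longrightarrow> poly (P m) z \<noteq> 0) sequentially"
proof -
  obtain \<eta> where \<eta>: "\<eta> > 0"
    "\<And>z. \<delta> \<le> infdist z lemniscate \<Longrightarrow> norm (1 - z\<^sup>2) \<le> 1 \<Longrightarrow> norm (1 - z\<^sup>2) \<le> 1 - 3 * \<eta>"
    using uniformly_inside_lemniscate[OF \<delta>] by blast
  have "eventually (\<lambda>m. 3 * (1 + 2 / \<delta>) ^ 11 / sqrt (real m) < 2 / 5) sequentially"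
    "eventually (\<lambda>m. 3 * (5000 / \<eta> ^ 4) / sqrt (real m) < 2 / 5) sequentially"
    by (rule eventually_const_over_sqrt_less; simp)+
  then show ?thesis
    using eventually_gt_at_top[of 0]
  proof eventually_elim
    case (elim m)
    show ?case
    proof (intro allI impI)
      fix z assume z: "\<delta> \<le> infdist z lemniscate"
      consider "z = -1" | "norm (1 - z\<^sup>2) < 1" "Re z < 0" "z \<noteq> -1" | "1 \<le> norm (1 - z\<^sup>2) \<or> 0 \<le> Re z"
        by linarith
      then show "poly (P m) z \<noteq> 0"
      proof cases
        case 1
        then show ?thesis using less_imp_neq[OF central_coeff_pos[of m]] by (simp add: poly_P_minus_1)
      next
        case 2
        then show ?thesis using \<eta> z elim by (intro P_nonzero_saddle[of \<eta>]) auto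
      next
        case 3
        show ?thesis
        proof (rule P_nonzero_endpoint[OF \<delta> far_from_right_lobe[OF z 3]])
          have "0 \<in> lemniscate" by (simp add: lemniscate_def)
          then show "\<delta> \<le> norm z" using infdist_le[of 0 lemniscate z] z by simp
          show "norm z \<le> 5 * norm (1 + z)"
          \<comment> \<open>Close to \<open>-1\<close> means inside the left loop, which is excluded in this case.\<close>
          proof (cases "norm (1 + z) < 1 / 4")
            case True
            have "norm (1 - z) \<le> 9 / 4"
              using norm_triangle_ineq4[of 2 "1 + z"] True by simp
            have "norm (1 - z\<^sup>2) = norm (1 + z) * norm (1 - z)"
              by (simp add: power2_eq_square algebra_simps flip: norm_mult)
            also have "\<dots> \<le> 1 / 4 * (9 / 4)"
              using True \<open>norm (1 - z) \<le> 9 / 4\<close> by (intro mult_mono) auto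
            finally have "norm (1 - z\<^sup>2) < 1" by simp
            moreover have "Re z < 0" using True abs_Re_le_cmod[of "1 + z"] by simp
            ultimately show ?thesis using 3 by simp
          next
            case False
            then show ?thesis using norm_triangle_ineq4[of "1 + z" 1] by simp
          qed
        qed (use elim in auto)
      qed
    qed
  qed
qed

theorem corollary1p8:
  shows "\<exists>\<epsilon>\<^sub>0>0. \<forall>\<epsilon>. 0 < \<epsilon> \<and> \<epsilon> < \<epsilon>\<^sub>0 \<longrightarrow>
    (\<lambda>m. Max ((\<lambda>z. infdist z lemniscate) ` zeros_outside \<epsilon> m)) \<longlonglongrightarrow> 0"
proof (intro exI[of _ "1/2"] conjI allI impI)
  fix \<epsilon> :: real assume \<epsilon>: "0 < \<epsilon> \<and> \<epsilon> < 1/2"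
  show "(\<lambda>m. Max ((\<lambda>z. infdist z lemniscate) ` zeros_outside \<epsilon> m)) \<longlonglongrightarrow> 0"
  proof (rule tendstoI)
    fix \<delta> :: real assume "\<delta> > 0"
    from eventually_P_nonzero_off_lemniscate[OF this] eventually_gt_at_top[of 0]
    show "eventually (\<lambda>m. dist (Max ((\<lambda>z. infdist z lemniscate) ` zeros_outside \<epsilon> m)) 0 < \<delta>) sequentially"
    proof eventually_elim
      case (elim m)
      let ?D = "(\<lambda>z. infdist z lemniscate) ` zeros_outside \<epsilon> m"
      have "zeros_outside \<epsilon> m \<noteq> {}"
        using \<epsilon> elim(2) by (simp add: zeros_outside_nonempty)
      then have "Max ?D \<in> ?D"
        by (intro Max_in finite_imageI finite_zeros_outside) auto
      then obtain z where z: "poly (P m) z = 0" "Max ?D = infdist z lemniscate"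
        unfolding zeros_outside_def by fastforce
      then have "infdist z lemniscate < \<delta>" using elim(1) not_le by blast
      then show ?case by (simp add: z(2) infdist_nonneg)
    qed
  qed
qed simp

end
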